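(* Let $\theta>0$. Under Assumptions 1 and 2 (stated in the context), there exist $g\in\mathbb{R}$ and $h:S\to\mathbb{R}$ such that for every $i\in S$ $$e^{\theta h(i)}=\sup_{\varphi\in \mathcal{P}(B(i))}\inf_{\psi\in \mathcal{P}(A(i))}\Big[\int_{A(i)}\int_{B(i)}\psi(da)\,\varphi(db)\, e^{\theta C(i,a,b)}\int_{0}^{\bar s} e^{\theta[\int_{0}^{s}\rho_{(i,a,b)}(t)dt-gs]}dF_{i,a,b}(s)\sum_{j\in S}e^{\theta h(j)}p_{i,j}(a,b)\Big].$$
   Context: Zero-sum semi-Markov game model. $S$ is a finite state space with the discrete topology. $A$ and $B$ are Borel spaces (action sets of players 1 and 2); for each $i\in S$, $A(i)\subset A$ and $B(i)\subset B$ are Borel subsets (admissible actions). $\mathbb{K}=\{(i,a,b): i\in S, a\in A(i), b\in B(i)\}$. $C:\mathbb{K}\to\mathbb{R}$ is the immediate cost; for each $(i,a,b)\in\mathbb{K}$, $\rho_{(i,a,b)}:[0,\infty)\to\mathbb{R}$ is the running cost; $F_{i,a,b}$ is the sojourn time distribution function, with $F_{i,a,b}(0)=0$; $[p_{i,j}(a,b)]$ is the controlled transition law, $\sum_{j\in S}p_{i,j}(a,b)=1$. $\mathcal{P}(E)$ is the set of probability measures on $E$. Assumption 1. (i) For each $i\in S$, $A(i)$ and $B(i)$ are compact. (ii) For each $i,j\in S$, $(a,b)\mapsto C(i,a,b)$ and $(a,b)\mapsto p_{i,j}(a,b)$ are continuous on $A(i)\times B(i)$. (iii) There is a constant $\bar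 s>0$ such that $F_{i,a,b}(\bar s)=1$ for all $(i,a,b)\in\mathbb{K}$, and for each $i\in S$ and each bounded measurable $u$, $(a,b)\mapsto\int_0^{\bar s}u(s)\,dF_{i,a,b}(s)$ is continuous on $A(i)\times B(i)$. (iv) For each $i\in S$, $(a,b,s)\mapsto\rho_{(i,a,b)}(s)$ is continuous on $A(i)\times B(i)\times[0,\bar s]$. $\Phi^1$ (resp. $\Phi^2$) is the set of stationary policies of player 1 (resp. 2), i.e. stochastic kernels $\phi^1$ on $A$ given $S$ with $\phi^1(A(i)|i)=1$ (resp. $\phi^2$ on $B$ given $S$ with $\phi^2(B(i)|i)=1$) for all $i\in S$. Under a pair $(\phi^1,\phi^2)\in\Phi^1\times\Phi^2$ the embedded chain $\{X_n\}$ of successive states is a Markov chain on $S$ with transition probabilities $\int_{A(i)}\int_{B(i)}p_{i,j}(a,b)\phi^2(db|i)\phi^1(da|i)$. Assumption 2. Under each stationary policy (pair) $(\phi^1,\phi^2)\in\Phi^1\times\Phi^2$, the embedded discrete-time Markov chain $\{X_n\}$ is irreducible. *)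

theory Defs
  imports "HOL-Probability.Probability"
begin

(* A sojourn time law on [0, oo) is encoded by its distribution function on the whole real line;
   F 0 = 0 together with monotonicity and the limit at -oo makes it vanish on the negative half-line.
   Integration against dF is integration against interval_measure F. *)
definition distribution_function :: "(real \<Rightarrow> real) \<Rightarrow> bool" where
  "distribution_function F \<longleftrightarrow>
     mono F \<and> (\<forall>x. continuous (at_right x) F) \<and> (F \<longlongrightarrow> 0) at_bot \<and> (F \<longlongrightarrow> 1) at_top"

definition prob_measures :: "'a::topological_space set \<Rightarrow> 'a measure set" where
  "prob_measures E = space (prob_algebra (restrict_space borel E))"

lemma prob_measures_iff:
  "M \<in> prob_measures E \<longleftrightarrow> sets M = sets (restrict_space borel E) \<and> prob_space M"
  by (auto simp: prob_measures_def space_prob_algebra)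

(* Stochastic kernels on the action space A, given the (finite, discrete) state space,
   concentrated on the admissible actions D i. *)
definition stationary_policies ::
    "'a::topological_space set \<Rightarrow> ('s \<Rightarrow> 'a set) \<Rightarrow> ('s \<Rightarrow> 'a measure) set" where
  "stationary_policies A D =
     {\<phi>. \<phi> \<in> count_space UNIV \<rightarrow>\<^sub>M prob_algebra (restrict_space borel A) \<and>
          (\<forall>i. measure (\<phi> i) (D i) = 1)}"

definition embedded_transition ::
    "('s \<Rightarrow> 'a set) \<Rightarrow> ('s \<Rightarrow> 'b set) \<Rightarrow> ('s \<Rightarrow> 's \<Rightarrow> 'a \<Rightarrow> 'b \<Rightarrow> real) \<Rightarrow>
     ('s \<Rightarrow> 'a measure) \<Rightarrow> ('s \<Rightarrow> 'b measure) \<Rightarrow> 's \<Rightarrow> 's \<Rightarrow> real" where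
  "embedded_transition DA DB p \<phi>1 \<phi>2 i j =
     (LINT a:DA i|\<phi>1 i. LINT b:DB i|\<phi>2 i. p i j a b)"

primrec n_step_transition ::
    "('s::finite \<Rightarrow> 's \<Rightarrow> real) \<Rightarrow> nat \<Rightarrow> 's \<Rightarrow> 's \<Rightarrow> real" where
  "n_step_transition P 0 i j = (if i = j then 1 else 0)"
| "n_step_transition P (Suc n) i j = (\<Sum>k\<in>UNIV. P i k * n_step_transition P n k j)"

definition irreducible_chain :: "('s::finite \<Rightarrow> 's \<Rightarrow> real) \<Rightarrow> bool" where
  "irreducible_chain P \<longleftrightarrow> (\<forall>i j. \<exists>n. n_step_transition P n i j > 0)"

end

theory Submission
  imports Defs
begin

text \<open>
  Write \<open>x i = exp (\<theta> * h i)\<close>. The equation then reads \<open>x = T\<^sub>g x\<close>, where \<open>T\<^sub>g\<close> sends a positive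
  vector to the vector of lower values of the one-stage games with payoff
  \<open>K\<^sub>g(i, a, b) * (\<Sum>j. x j * p i j a b)\<close>, and \<open>K\<^sub>g > 0\<close> collects the immediate cost and the expected
  exponential of the running cost minus \<open>g\<close> per unit time. The operator \<open>T\<^sub>g\<close> is monotone, positively
  homogeneous and Lipschitz, so the task is a nonlinear eigenvalue problem with a parameter.

  For fixed \<open>g\<close>, Brouwer's theorem on the simplex, applied to \<open>T\<^sub>g x\<close> divided by its coordinate sum,
  gives an eigenvector (\<open>positive_eigenvector\<close>). Irreducibility enters through \<open>shapley_escape\<close>: if a
  nonzero \<open>x \<ge> 0\<close> has zero coordinates, then \<open>T\<^sub>g\<close> makes at least one of them positive. Otherwise a
  pure reply of the minimizer to a pure policy of the maximizer would make the zero set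
  closed for the embedded chain. Hence the normalization is possible, every eigenvector found is
  strictly positive, and its eigenvalue \<open>\<kappa> g\<close> is positive.

  The parameter is then adjusted so that \<open>\<kappa> g = 1\<close>. By a Collatz-Wielandt comparison
  (\<open>eigenvalue_comparison\<close>), inequalities between the weights \<open>K\<^sub>g\<close> carry over to the eigenvalues.
  Since sojourn times are at most \<open>sbar\<close>, the weights satisfy
  \<open>K\<^bsub>g'\<^esub> \<le> K\<^sub>g \<le> exp (\<theta> * sbar * (g' - g)) * K\<^bsub>g'\<^esub>\<close> for \<open>g \<le> g'\<close>, so \<open>ln (\<kappa> g)\<close> is Lipschitz. For large
  \<open>g\<close> all weights are at most 1 and for very negative \<open>g\<close> all are at least 1 (\<open>weight_le_one\<close>,
  \<open>weight_ge_one\<close>), because sojourn times put uniformly little mass near 0 (\<open>no_mass_near_zero\<close>): this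
  is a Dini argument resting on \<open>F i a b 0 = 0\<close> and the continuous dependence of the sojourn law on the
  actions. The intermediate value theorem yields \<open>g\<close> with \<open>\<kappa> g = 1\<close>.
\<close>

section \<open>Values of zero-sum games on compact action sets\<close>

definition expected_payoff :: "'a measure \<Rightarrow> 'b measure \<Rightarrow> ('a \<Rightarrow> 'b \<Rightarrow> real) \<Rightarrow> real" where
  "expected_payoff \<psi> \<phi> f = (LINT a|\<psi>. LINT b|\<phi>. f a b)"

text \<open>Lower value of the zero-sum game on mixed actions, taken in the reals so that it can be
estimated by ordinary arithmetic. Real suprema and infima are meaningful only for bounded families;
the extended-real form is recovered in \<open>ereal_game_value\<close> for continuous payoffs on compact sets.\<close>
definition game_value ::
    "'a::topological_space set \<Rightarrow> 'b::topological_space set \<Rightarrow> ('a \<Rightarrow> 'b \<Rightarrow> real) \<Rightarrow> real" where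
  "game_value D E f =
     (SUP \<phi>\<in>prob_measures E. INF \<psi>\<in>prob_measures D. expected_payoff \<psi> \<phi> f)"

lemma space_prob_measures: "M \<in> prob_measures E \<Longrightarrow> space M = E"
  by (auto simp: prob_measures_iff space_restrict_space dest: sets_eq_imp_space_eq)

lemma return_in_prob_measures:
  assumes "x \<in> E" shows "return (restrict_space borel E) x \<in> prob_measures E"
  using assms by (auto simp: prob_measures_iff space_restrict_space intro!: prob_space_return)

lemma prob_measures_nonempty: "E \<noteq> {} \<Longrightarrow> prob_measures E \<noteq> {}"
  using return_in_prob_measures by fastforce

text \<open>Passing from joint continuity to continuity in one variable is needed for both kinds of
product that occur below: pairs of actions, and an action pair with a time.\<close>
lemma continuous_on_section:
  assumes "continuous_on (X \<times> Y) (\<lambda>(x, y). f x y)"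
  shows "x \<in> X \<Longrightarrow> continuous_on Y (f x)"
    and "y \<in> Y \<Longrightarrow> continuous_on X (\<lambda>x. f x y)"
proof -
  show "continuous_on Y (f x)" if "x \<in> X"
  proof -
    have "continuous_on Y (\<lambda>y. (\<lambda>(x, y). f x y) (x, y))"
      using that by (intro continuous_on_compose2[OF assms] continuous_intros) auto
    then show ?thesis by simp
  qed
  show "continuous_on X (\<lambda>x. f x y)" if "y \<in> Y"
  proof -
    have "continuous_on X (\<lambda>x. (\<lambda>(x, y). f x y) (x, y))"
      using that by (intro continuous_on_compose2[OF assms] continuous_intros) auto
    then show ?thesis by simp
  qed
qed

definition continuous_payoff ::
    "'a::topological_space set \<Rightarrow> 'b::topological_space set \<Rightarrow> ('a \<Rightarrow> 'b \<Rightarrow> real) \<Rightarrow> bool" where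
  "continuous_payoff D E f \<longleftrightarrow> continuous_on (D \<times> E) (\<lambda>(a, b). f a b)"

locale compact_game =
  fixes D :: "'a::polish_space set" and E :: "'b::polish_space set"
  assumes compact_D: "compact D" and compact_E: "compact E"
    and D_nonempty: "D \<noteq> {}" and E_nonempty: "E \<noteq> {}"
begin

lemma payoff_const: "continuous_payoff D E (\<lambda>_ _. c)"
  by (simp add: continuous_payoff_def split_def)

lemma payoff_bounded:
  assumes "continuous_payoff D E f"
  obtains M where "\<And>a b. a \<in> D \<Longrightarrow> b \<in> E \<Longrightarrow> \<bar>f a b\<bar> \<le> M"
proof -
  have "compact ((\<lambda>(a, b). f a b) ` (D \<times> E))"
    using assms compact_D compact_E unfolding continuous_payoff_def
    by (intro compact_continuous_image compact_Times)
  then obtain M where "\<forall>x\<in>(\<lambda>(a, b). f a b) ` (D \<times> E). norm x \<le> M"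
    using compact_imp_bounded bounded_iff by blast
  then show ?thesis by (intro that[of M]) auto
qed

text \<open>Second countability of the action spaces makes the Borel sets of the product coincide with
the product of the Borel sets, so a continuous payoff is measurable for the product measure and the
inner integral is measurable in the outer variable.\<close>
lemma payoff_measurable:
  assumes f: "continuous_payoff D E f" and \<psi>: "\<psi> \<in> prob_measures D" and \<phi>: "\<phi> \<in> prob_measures E"
  shows "(\<lambda>(a, b). f a b) \<in> borel_measurable (\<psi> \<Otimes>\<^sub>M \<phi>)"
proof -
  have [measurable]: "(\<lambda>x. x) \<in> \<psi> \<rightarrow>\<^sub>M borel" "(\<lambda>x. x) \<in> \<phi> \<rightarrow>\<^sub>M borel"
    using \<psi> \<phi> by (auto simp: prob_measures_iff cong: measurable_cong_sets
        intro: measurable_restrict_space1)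
  have "(\<lambda>x. (fst x, snd x)) \<in> \<psi> \<Otimes>\<^sub>M \<phi> \<rightarrow>\<^sub>M borel \<Otimes>\<^sub>M borel"
    by measurable
  then have "(\<lambda>x. x) \<in> \<psi> \<Otimes>\<^sub>M \<phi> \<rightarrow>\<^sub>M restrict_space borel (D \<times> E)"
    using \<psi> \<phi> by (intro measurable_restrict_space2)
      (auto simp: space_pair_measure space_prob_measures borel_prod)
  from measurable_compose[OF this borel_measurable_continuous_on_restrict[OF f[unfolded continuous_payoff_def]]]
  show ?thesis .
qed

lemma payoff_integrable:
  assumes f: "continuous_payoff D E f" and \<psi>: "\<psi> \<in> prob_measures D" and \<phi>: "\<phi> \<in> prob_measures E"
  shows "a \<in> D \<Longrightarrow> integrable \<phi> (f a)"
    and "integrable \<psi> (\<lambda>a. LINT b|\<phi>. f a b)"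
proof -
  interpret \<psi>: prob_space \<psi> using \<psi> by (simp add: prob_measures_iff)
  interpret \<phi>: prob_space \<phi> using \<phi> by (simp add: prob_measures_iff)
  note [measurable] = payoff_measurable[OF f \<psi> \<phi>]
  obtain M where M: "\<And>a b. a \<in> D \<Longrightarrow> b \<in> E \<Longrightarrow> \<bar>f a b\<bar> \<le> M"
    using payoff_bounded[OF f] by blast
  show inner: "integrable \<phi> (f a)" if "a \<in> D" for a
  proof (rule \<phi>.integrable_const_bound)
    show "f a \<in> borel_measurable \<phi>"
      using measurable_Pair2[OF payoff_measurable[OF f \<psi> \<phi>]] that
      by (simp add: space_prob_measures[OF \<psi>])
    show "AE x in \<phi>. norm (f a x) \<le> M"
      using M that by (auto simp: space_prob_measures[OF \<phi>])
  qed
  show "integrable \<psi> (\<lambda>a. LINT b|\<phi>. f a b)"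
  proof (rule \<psi>.integrable_const_bound)
    show "(\<lambda>a. LINT b|\<phi>. f a b) \<in> borel_measurable \<psi>" by measurable
    have "\<bar>LINT b|\<phi>. f a b\<bar> \<le> M" if "a \<in> D" for a
    proof -
      have "\<bar>LINT b|\<phi>. f a b\<bar> \<le> (LINT b|\<phi>. \<bar>f a b\<bar>)"
        by (rule integral_abs_bound)
      also have "\<dots> \<le> (LINT b|\<phi>. M)"
        using M that inner by (intro integral_mono) (auto simp: space_prob_measures[OF \<phi>])
      finally show ?thesis by (simp add: \<phi>.prob_space)
    qed
    then show "AE a in \<psi>. norm (LINT b|\<phi>. f a b) \<le> M"
      by (auto simp: space_prob_measures[OF \<psi>])
  qed
qed

lemma expected_payoff_affine_mono:
  assumes f: "continuous_payoff D E f" and f': "continuous_payoff D E f'"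
    and \<psi>: "\<psi> \<in> prob_measures D" and \<phi>: "\<phi> \<in> prob_measures E"
    and le: "\<And>a b. a \<in> D \<Longrightarrow> b \<in> E \<Longrightarrow> f a b \<le> c * f' a b + d"
  shows "expected_payoff \<psi> \<phi> f \<le> c * expected_payoff \<psi> \<phi> f' + d"
proof -
  interpret \<psi>: prob_space \<psi> using \<psi> by (simp add: prob_measures_iff)
  interpret \<phi>: prob_space \<phi> using \<phi> by (simp add: prob_measures_iff)
  have inner: "(LINT b|\<phi>. f a b) \<le> c * (LINT b|\<phi>. f' a b) + d" if a: "a \<in> D" for a
  proof -
    have "(LINT b|\<phi>. f a b) \<le> (LINT b|\<phi>. c * f' a b + d)"
      using le a payoff_integrable(1)[OF f \<psi> \<phi>] payoff_integrable(1)[OF f' \<psi> \<phi>]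
      by (intro integral_mono) (auto simp: space_prob_measures[OF \<phi>])
    also have "\<dots> = c * (LINT b|\<phi>. f' a b) + d"
      using payoff_integrable(1)[OF f' \<psi> \<phi> a] by (simp add: \<phi>.prob_space)
    finally show ?thesis .
  qed
  have "expected_payoff \<psi> \<phi> f \<le> (LINT a|\<psi>. c * (LINT b|\<phi>. f' a b) + d)"
    unfolding expected_payoff_def
    using inner payoff_integrable(2)[OF f \<psi> \<phi>] payoff_integrable(2)[OF f' \<psi> \<phi>]
    by (intro integral_mono) (auto simp: space_prob_measures[OF \<psi>])
  also have "\<dots> = c * expected_payoff \<psi> \<phi> f' + d"
    using payoff_integrable(2)[OF f' \<psi> \<phi>] by (simp add: \<psi>.prob_space expected_payoff_def)
  finally show ?thesis .
qed

lemma expected_payoff_const: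
  assumes "\<psi> \<in> prob_measures D" "\<phi> \<in> prob_measures E"
  shows "expected_payoff \<psi> \<phi> (\<lambda>_ _. c) = c"
proof -
  interpret \<psi>: prob_space \<psi> using assms by (simp add: prob_measures_iff)
  interpret \<phi>: prob_space \<phi> using assms by (simp add: prob_measures_iff)
  show ?thesis by (simp add: expected_payoff_def \<psi>.prob_space \<phi>.prob_space)
qed

lemma expected_payoff_bounds:
  assumes f: "continuous_payoff D E f"
  obtains M where "\<And>\<psi> \<phi>. \<psi> \<in> prob_measures D \<Longrightarrow> \<phi> \<in> prob_measures E \<Longrightarrow>
    \<bar>expected_payoff \<psi> \<phi> f\<bar> \<le> M"
proof -
  obtain M where M: "\<And>a b. a \<in> D \<Longrightarrow> b \<in> E \<Longrightarrow> \<bar>f a b\<bar> \<le> M"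
    using payoff_bounded[OF f] by blast
  have "\<bar>expected_payoff \<psi> \<phi> f\<bar> \<le> M"
    if "\<psi> \<in> prob_measures D" "\<phi> \<in> prob_measures E" for \<psi> \<phi>
  proof -
    have "expected_payoff \<psi> \<phi> f \<le> 0 * expected_payoff \<psi> \<phi> (\<lambda>_ _. 0) + M"
      using M by (intro expected_payoff_affine_mono f payoff_const that) (smt (verit))
    moreover have "expected_payoff \<psi> \<phi> (\<lambda>_ _. - M) \<le> 1 * expected_payoff \<psi> \<phi> f + 0"
      using M by (intro expected_payoff_affine_mono f payoff_const that) (smt (verit))
    ultimately show ?thesis by (simp add: expected_payoff_const[OF that])
  qed
  then show ?thesis using that by blast
qed

lemma game_value_bdd:
  assumes f: "continuous_payoff D E f"
  shows "\<phi> \<in> prob_measures E \<Longrightarrow> bdd_below ((\<lambda>\<psi>. expected_payoff \<psi> \<phi> f) ` prob_measures D)"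
    and "bdd_above ((\<lambda>\<phi>. INF \<psi>\<in>prob_measures D. expected_payoff \<psi> \<phi> f) ` prob_measures E)"
proof -
  obtain M where M: "\<And>\<psi> \<phi>. \<psi> \<in> prob_measures D \<Longrightarrow> \<phi> \<in> prob_measures E \<Longrightarrow>
    \<bar>expected_payoff \<psi> \<phi> f\<bar> \<le> M" using expected_payoff_bounds[OF f] by blast
  show b: "bdd_below ((\<lambda>\<psi>. expected_payoff \<psi> \<phi> f) ` prob_measures D)"
    if "\<phi> \<in> prob_measures E" for \<phi>
    using M[OF _ that] by (intro bdd_belowI2[of _ "- M"]) (smt (verit))
  obtain \<psi> where \<psi>: "\<psi> \<in> prob_measures D"
    using prob_measures_nonempty[OF D_nonempty] by blast
  show "bdd_above ((\<lambda>\<phi>. INF \<psi>\<in>prob_measures D. expected_payoff \<psi> \<phi> f) ` prob_measures E)"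
    using M[OF \<psi>] by (intro bdd_aboveI2[of _ _ M] cINF_lower2[OF b \<psi>]) (auto simp: abs_le_iff)
qed

text \<open>The single estimate about game values from which the monotonicity, the positive homogeneity,
the Lipschitz bound and all comparisons of Shapley operators follow: expected payoffs respect
affine bounds with positive slope, and increasing affine maps commute with infima and suprema.\<close>
lemma game_value_affine_mono:
  assumes f: "continuous_payoff D E f" and f': "continuous_payoff D E f'" and c: "c > 0"
    and le: "\<And>a b. a \<in> D \<Longrightarrow> b \<in> E \<Longrightarrow> f a b \<le> c * f' a b + d"
  shows "game_value D E f \<le> c * game_value D E f' + d"
  unfolding game_value_def[of _ _ f]
proof (rule cSUP_least[OF prob_measures_nonempty[OF E_nonempty]])
  fix \<phi> assume \<phi>: "\<phi> \<in> prob_measures E"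
  define m where "m = (INF \<psi>\<in>prob_measures D. expected_payoff \<psi> \<phi> f)"
  have "(m - d) / c \<le> (INF \<psi>\<in>prob_measures D. expected_payoff \<psi> \<phi> f')"
  proof (rule cINF_greatest[OF prob_measures_nonempty[OF D_nonempty]])
    fix \<psi> assume \<psi>: "\<psi> \<in> prob_measures D"
    have "m \<le> expected_payoff \<psi> \<phi> f"
      unfolding m_def by (rule cINF_lower[OF game_value_bdd(1)[OF f \<phi>] \<psi>])
    also have "\<dots> \<le> c * expected_payoff \<psi> \<phi> f' + d"
      by (rule expected_payoff_affine_mono[OF f f' \<psi> \<phi> le])
    finally show "(m - d) / c \<le> expected_payoff \<psi> \<phi> f'"
      using c by (simp add: field_simps)
  qed
  also have "\<dots> \<le> game_value D E f'"
    unfolding game_value_def by (rule cSUP_upper[OF \<phi> game_value_bdd(2)[OF f']])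
  finally show "m \<le> c * game_value D E f' + d"
    using c by (simp add: field_simps)
qed

lemma game_value_const: "game_value D E (\<lambda>_ _. c) = c"
proof -
  have "(INF \<psi>\<in>prob_measures D. expected_payoff \<psi> \<phi> (\<lambda>_ _. c)) = c"
    if "\<phi> \<in> prob_measures E" for \<phi>
  proof -
    have "(INF \<psi>\<in>prob_measures D. expected_payoff \<psi> \<phi> (\<lambda>_ _. c)) = (INF \<psi>\<in>prob_measures D. c)"
      using that by (intro INF_cong refl expected_payoff_const)
    then show ?thesis using prob_measures_nonempty[OF D_nonempty] by simp
  qed
  then have "game_value D E (\<lambda>_ _. c) = (SUP \<phi>\<in>prob_measures E. c)"
    unfolding game_value_def by (intro SUP_cong refl)
  then show ?thesis using prob_measures_nonempty[OF E_nonempty] by simp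
qed

text \<open>The maximizer may play the pure action \<open>b\<close>; by compactness the payoff against it has a
positive minimum over the opponent's actions, which bounds every expected payoff from below.
Read contrapositively: if the value is not positive, then every action of the maximizer has a
pure reply that makes the payoff nonpositive.\<close>
lemma game_value_pos:
  assumes f: "continuous_payoff D E f" and b: "b \<in> E" and pos: "\<And>a. a \<in> D \<Longrightarrow> f a b > 0"
  shows "game_value D E f > 0"
proof -
  obtain a0 where a0: "a0 \<in> D" "\<And>a. a \<in> D \<Longrightarrow> f a0 b \<le> f a b"
    using continuous_attains_inf[OF compact_D D_nonempty
        continuous_on_section(2)[OF f[unfolded continuous_payoff_def] b]] by blast
  define \<phi> where "\<phi> = return (restrict_space borel E) b"
  have \<phi>: "\<phi> \<in> prob_measures E"
    unfolding \<phi>_def by (rule return_in_prob_measures[OF b])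
  have "f a0 b \<le> (INF \<psi>\<in>prob_measures D. expected_payoff \<psi> \<phi> f)"
  proof (rule cINF_greatest[OF prob_measures_nonempty[OF D_nonempty]])
    fix \<psi> assume \<psi>: "\<psi> \<in> prob_measures D"
    interpret \<psi>: prob_space \<psi> using \<psi> by (simp add: prob_measures_iff)
    have inner: "(LINT b|\<phi>. f a b) = f a b" if "a \<in> D" for a
    proof -
      have "f a \<in> borel_measurable (restrict_space borel E)"
        using borel_measurable_integrable[OF payoff_integrable(1)[OF f \<psi> \<phi> that]]
        by (simp add: \<phi>_def)
      then show ?thesis
        using b by (simp add: \<phi>_def integral_return space_restrict_space)
    qed
    have "f a0 b = (LINT a|\<psi>. f a0 b)" by (simp add: \<psi>.prob_space)
    also have "\<dots> \<le> expected_payoff \<psi> \<phi> f"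
      unfolding expected_payoff_def using a0 inner payoff_integrable(2)[OF f \<psi> \<phi>]
      by (intro integral_mono) (auto simp: space_prob_measures[OF \<psi>])
    finally show "f a0 b \<le> expected_payoff \<psi> \<phi> f" .
  qed
  also have "\<dots> \<le> game_value D E f"
    unfolding game_value_def by (rule cSUP_upper[OF \<phi> game_value_bdd(2)[OF f]])
  finally show ?thesis using pos[OF a0(1)] by simp
qed

lemma ereal_game_value:
  assumes f: "continuous_payoff D E f"
  shows "ereal (game_value D E f) =
    (SUP \<phi>\<in>prob_measures E. INF \<psi>\<in>prob_measures D. ereal (expected_payoff \<psi> \<phi> f))"
proof -
  have inner: "(INF \<psi>\<in>prob_measures D. ereal (expected_payoff \<psi> \<phi> f)) =
      ereal (INF \<psi>\<in>prob_measures D. expected_payoff \<psi> \<phi> f)" if \<phi>: "\<phi> \<in> prob_measures E" for \<phi>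
    using ereal_Inf'[OF game_value_bdd(1)[OF f \<phi>]] prob_measures_nonempty[OF D_nonempty]
    by (simp add: image_image)
  have "ereal (game_value D E f) =
      (SUP \<phi>\<in>prob_measures E. ereal (INF \<psi>\<in>prob_measures D. expected_payoff \<psi> \<phi> f))"
    unfolding game_value_def
  proof (rule ereal_SUP)
    obtain \<psi> \<phi> where \<psi>: "\<psi> \<in> prob_measures D" and \<phi>: "\<phi> \<in> prob_measures E"
      using prob_measures_nonempty[OF D_nonempty] prob_measures_nonempty[OF E_nonempty] by blast
    let ?u = "SUP \<phi>\<in>prob_measures E. ereal (INF \<psi>\<in>prob_measures D. expected_payoff \<psi> \<phi> f)"
    have "?u \<le> ereal (game_value D E f)"
      unfolding game_value_def
      by (intro SUP_least) (simp add: cSUP_upper[OF _ game_value_bdd(2)[OF f]])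
    moreover have "ereal (INF \<psi>\<in>prob_measures D. expected_payoff \<psi> \<phi> f) \<le> ?u"
      by (rule SUP_upper[OF \<phi>])
    ultimately show "\<bar>?u\<bar> \<noteq> \<infinity>" by auto
  qed
  also have "\<dots> = (SUP \<phi>\<in>prob_measures E. INF \<psi>\<in>prob_measures D. ereal (expected_payoff \<psi> \<phi> f))"
    by (intro SUP_cong refl inner[symmetric])
  finally show ?thesis .
qed

end

section \<open>Positive eigenvectors of monotone maps\<close>

definition std_simplex :: "(real ^ 's::finite) set" where
  "std_simplex = {x. (\<forall>i. 0 \<le> x $ i) \<and> (\<Sum>i\<in>UNIV. x $ i) = 1}"

lemma compact_std_simplex: "compact (std_simplex :: (real ^ 's::finite) set)"
proof -
  have "bounded (std_simplex :: (real ^ 's) set)"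
  proof (rule boundedI)
    fix x :: "real ^ 's" assume x: "x \<in> std_simplex"
    have "norm x \<le> (\<Sum>i\<in>UNIV. \<bar>x $ i\<bar>)" by (rule norm_le_l1_cart)
    also have "\<dots> = 1" using x by (simp add: std_simplex_def)
    finally show "norm x \<le> 1" .
  qed
  moreover have "closed (std_simplex :: (real ^ 's) set)"
    unfolding std_simplex_def
    by (intro closed_Collect_conj closed_Collect_all closed_Collect_le closed_Collect_eq
        continuous_intros)
  ultimately show ?thesis by (simp add: compact_eq_bounded_closed)
qed

lemma convex_std_simplex: "convex (std_simplex :: (real ^ 's::finite) set)"
proof (rule convexI)
  fix x y :: "real ^ 's" and u v :: real
  assume *: "x \<in> std_simplex" "y \<in> std_simplex" "0 \<le> u" "0 \<le> v" "u + v = 1"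
  then show "u *\<^sub>R x + v *\<^sub>R y \<in> std_simplex"
    by (auto simp: std_simplex_def sum.distrib simp flip: sum_distrib_left)
qed

lemma std_simplex_nonempty: "(std_simplex :: (real ^ 's::finite) set) \<noteq> {}"
proof -
  have "(\<chi> i. 1 / real CARD('s)) \<in> (std_simplex :: (real ^ 's) set)"
    by (auto simp: std_simplex_def)
  then show ?thesis by blast
qed

text \<open>A nonlinear Perron theorem. Brouwer's theorem is applied to the normalized map
\<open>x \<mapsto> T x / (\<Sum>i. T x $ i)\<close> on the simplex. The hypothesis \<open>escape\<close>, which is what irreducibility
will provide, is used twice: \<open>T x\<close> cannot vanish on the boundary of the simplex, so the
normalization makes sense; and a fixed point cannot have a zero coordinate, because \<open>T\<close> would
make one of its zero coordinates positive.\<close>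
lemma positive_eigenvector:
  fixes T :: "real ^ 's::finite \<Rightarrow> real ^ 's"
  assumes cont: "continuous_on std_simplex T"
    and nonneg: "\<And>x i. x \<in> std_simplex \<Longrightarrow> 0 \<le> T x $ i"
    and pos: "\<And>x i. (\<And>j. 0 < x $ j) \<Longrightarrow> 0 < T x $ i"
    and escape: "\<And>x. x \<in> std_simplex \<Longrightarrow> \<exists>i. x $ i = 0 \<Longrightarrow> \<exists>i. x $ i = 0 \<and> 0 < T x $ i"
  obtains \<kappa> x where "0 < \<kappa>" "\<And>i. 0 < x $ i" "T x = \<kappa> *\<^sub>R x"
proof -
  define s where "s x = (\<Sum>i\<in>UNIV. T x $ i)" for x
  have s_pos: "s x > 0" if x: "x \<in> std_simplex" for x
  proof -
    have "\<exists>i. 0 < T x $ i"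
    proof (cases "\<exists>i. x $ i = 0")
      case True
      then show ?thesis using escape[OF x] by blast
    next
      case False
      then have "\<And>j. 0 < x $ j"
        using x by (auto simp: std_simplex_def less_le)
      then show ?thesis using pos by blast
    qed
    then show ?thesis
      unfolding s_def using nonneg[OF x] by (auto intro: sum_pos2)
  qed
  have "continuous_on std_simplex (\<lambda>x. inverse (s x) *\<^sub>R T x)"
    unfolding s_def
    using s_pos cont by (intro continuous_intros) (force simp: s_def)+
  moreover have "(\<lambda>x. inverse (s x) *\<^sub>R T x) \<in> std_simplex \<rightarrow> std_simplex"
  proof
    fix x :: "real ^ 's" assume x: "x \<in> std_simplex"
    show "inverse (s x) *\<^sub>R T x \<in> std_simplex"
      using s_pos[OF x] nonneg[OF x]
      by (auto simp: std_simplex_def s_def simp flip: sum_distrib_left)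
  qed
  ultimately obtain x where x: "x \<in> std_simplex" and fixpt: "inverse (s x) *\<^sub>R T x = x"
    using brouwer[OF compact_std_simplex convex_std_simplex std_simplex_nonempty] by blast
  have eig: "T x = s x *\<^sub>R x"
    using s_pos[OF x] by (subst fixpt[symmetric]) simp
  have "0 < x $ i" for i
  proof (rule ccontr)
    assume "\<not> 0 < x $ i"
    then have "x $ i = 0" using x by (auto simp: std_simplex_def not_less intro: antisym)
    then obtain k where "x $ k = 0" "0 < T x $ k" using escape[OF x] by blast
    then show False by (simp add: eig)
  qed
  then show ?thesis using that s_pos[OF x] eig by blast
qed

text \<open>The Collatz-Wielandt argument: scale \<open>x\<close> until it just dominates \<open>y\<close> and evaluate at a
coordinate where the two agree. With the identity in place of one operator it also compares an
eigenvalue with 1.\<close>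
lemma eigenvalue_comparison:
  fixes T S :: "real ^ 's::finite \<Rightarrow> real ^ 's"
  assumes x: "\<And>i. 0 < x $ i" "T x = \<kappa> *\<^sub>R x" and y: "\<And>i. 0 < y $ i" "S y = \<mu> *\<^sub>R y"
    and mono: "\<And>t i. 0 < t \<Longrightarrow> (\<And>j. y $ j \<le> t * x $ j) \<Longrightarrow> S y $ i \<le> c * t * T x $ i"
  shows "\<mu> \<le> c * \<kappa>"
proof -
  \<comment> \<open>the least factor for which the multiple of x dominates y\<close>
  define t where "t = Max (range (\<lambda>i. y $ i / x $ i))"
  have "t \<in> range (\<lambda>i. y $ i / x $ i)" unfolding t_def by (intro Max_in) auto
  then obtain k where k: "t = y $ k / x $ k" by blast
  have t_pos: "t > 0" using x(1)[of k] y(1)[of k] by (simp add: k)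
  have "y $ j \<le> t * x $ j" for j
  proof -
    have "y $ j / x $ j \<le> t" unfolding t_def by (intro Max_ge) auto
    then show ?thesis using x(1)[of j] by (simp add: field_simps)
  qed
  from mono[OF t_pos this, of k] have "\<mu> * y $ k \<le> c * t * (\<kappa> * x $ k)"
    by (simp add: x y)
  also have "\<dots> = c * \<kappa> * y $ k" using x(1)[of k] by (simp add: k)
  finally show ?thesis using y(1)[of k] by simp
qed

lemma closed_class_not_left:
  assumes "\<And>i j. i \<in> Z \<Longrightarrow> j \<notin> Z \<Longrightarrow> P i j = 0" and "i \<in> Z" "j \<notin> Z"
  shows "n_step_transition P n i j = 0"
  using assms(2,3)
proof (induction n arbitrary: i)
  case (Suc n)
  have "P i k * n_step_transition P n k j = 0" for k
    using Suc assms(1) by (cases "k \<in> Z") auto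
  then show ?case by (simp add: sum.neutral del: mult_eq_0_iff)
qed auto

section \<open>Exponential weights of bounded sojourn times\<close>

lemma distribution_function_interval_measure:
  assumes "distribution_function F"
  shows "real_distribution (interval_measure F)" "cdf (interval_measure F) = F"
  using assms unfolding distribution_function_def
  by (auto intro!: real_distribution_interval_measure cdf_interval_measure dest: monoD)

text \<open>Continuity of the integral when the integrand and the measure vary together. Near \<open>x\<close> the
integrand is uniformly close to \<open>w x\<close> on the compact interval, which costs little because the
measures have mass one; what remains is the fixed bounded integrand \<open>w x\<close>, for which the
continuity in the measure is assumed.\<close>
lemma continuous_on_integral_varying_measure:
  fixes \<mu> :: "'x::metric_space \<Rightarrow> real measure" and w :: "'x \<Rightarrow> real \<Rightarrow> real"
  assumes prob: "\<And>x. x \<in> X \<Longrightarrow> real_distribution (\<mu> x)"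
    and w: "continuous_on (X \<times> {l..u}) (\<lambda>(x, s). w x s)"
    and feller: "\<And>v. v \<in> borel_measurable borel \<Longrightarrow> bounded (range v) \<Longrightarrow>
      continuous_on X (\<lambda>x. LINT s:{l..u}|\<mu> x. (v s :: real))"
  shows "continuous_on X (\<lambda>x. LINT s:{l..u}|\<mu> x. w x s)"
proof -
  note cont = continuous_on_section(1)[OF w]
  have meas: "(\<lambda>s. indicator {l..u} s *\<^sub>R w x s) \<in> borel_measurable borel" if "x \<in> X" for x
    using cont[OF that] set_measurable_continuous_on[of "{l..u}" "w x"]
    by (simp add: set_borel_measurable_def)
  have bdd: "bounded (range (\<lambda>s. indicator {l..u} s *\<^sub>R w x s))" if x: "x \<in> X" for x
  proof -
    have "bounded (w x ` {l..u})"
      by (intro compact_imp_bounded compact_continuous_image cont x compact_Icc)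
    then have "bounded (insert 0 (w x ` {l..u}))" by simp
    then show ?thesis by (rule bounded_subset) (auto simp: indicator_def)
  qed
  have int: "set_integrable (\<mu> y) {l..u} (w x)" if x: "x \<in> X" and y: "y \<in> X" for x y
  proof -
    interpret real_distribution "\<mu> y" using prob[OF y] .
    obtain M where M: "\<And>s. norm (indicator {l..u} s *\<^sub>R w x s) \<le> M"
      using bdd[OF x] by (auto simp: bounded_iff)
    show ?thesis unfolding set_integrable_def
      using meas[OF x] M by (intro integrable_const_bound[of _ M]) auto
  qed
  show ?thesis
    unfolding continuous_on_iff
  proof (intro ballI allI impI)
    fix x :: 'x and e :: real assume x: "x \<in> X" and e: "e > 0"
    have "continuous_on X (\<lambda>y. LINT s:{l..u}|\<mu> y. indicator {l..u} s *\<^sub>R w x s)"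
      by (rule feller[OF meas[OF x] bdd[OF x]])
    then have "continuous_on X (\<lambda>y. LINT s:{l..u}|\<mu> y. w x s)"

      unfolding set_lebesgue_integral_def scaleR_scaleR indicator_inter_arith[symmetric] Int_absorb .
    then obtain d1 where d1: "d1 > 0" "\<And>y. y \<in> X \<Longrightarrow> dist y x < d1 \<Longrightarrow>
        \<bar>(LINT s:{l..u}|\<mu> y. w x s) - (LINT s:{l..u}|\<mu> x. w x s)\<bar> < e / 2"
      unfolding continuous_on_iff dist_real_def using x e by (meson half_gt_zero)
    obtain X0 where X0: "x \<in> X0" "open X0"
        "\<forall>y\<in>X0 \<inter> X. \<forall>s\<in>{l..u}. dist ((\<lambda>(x, s). w x s) (y, s)) ((\<lambda>(x, s). w x s) (x, s)) \<le> e / 2"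
      using continuous_on_prod_compactE[OF w compact_Icc x half_gt_zero[OF e]] by blast
    obtain d2 where d2: "d2 > 0" "\<And>y. dist y x < d2 \<Longrightarrow> y \<in> X0"
      using X0 unfolding open_dist by blast
    have "dist (LINT s:{l..u}|\<mu> y. w y s) (LINT s:{l..u}|\<mu> x. w x s) < e"
      if y: "y \<in> X" and d: "dist y x < min d1 d2" for y
    proof -
      interpret real_distribution "\<mu> y" using prob[OF y] .
      have "\<bar>(LINT s:{l..u}|\<mu> y. w y s) - (LINT s:{l..u}|\<mu> y. w x s)\<bar>
          = \<bar>LINT s:{l..u}|\<mu> y. w y s - w x s\<bar>"
        using int x y by simp
      also have "\<dots> \<le> (LINT s|\<mu> y. \<bar>indicator {l..u} s *\<^sub>R (w y s - w x s)\<bar>)"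
        unfolding set_lebesgue_integral_def by (rule integral_abs_bound)
      also have "\<dots> \<le> (LINT s|\<mu> y. e / 2)"
      proof (rule integral_mono)
        show "integrable (\<mu> y) (\<lambda>s. \<bar>indicator {l..u} s *\<^sub>R (w y s - w x s)\<bar>)"
          using set_integral_diff(1)[OF int[OF y y] int[OF x y]]
          by (intro integrable_abs) (simp add: set_integrable_def)
        show "\<bar>indicator {l..u} s *\<^sub>R (w y s - w x s)\<bar> \<le> e / 2" for s
          using X0(3) d2(2)[of y] d y e by (auto simp: indicator_def dist_real_def)
      qed simp
      also have "\<dots> = e / 2" using prob_space by simp
      finally show ?thesis using d1(2)[OF y] d unfolding dist_real_def by linarith
    qed
    then show "\<exists>d>0. \<forall>y\<in>X. dist y x < d \<longrightarrow>
        dist (LINT s:{l..u}|\<mu> y. w y s) (LINT s:{l..u}|\<mu> x. w x s) < e"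
      using d1(1) d2(1) by (intro exI[of _ "min d1 d2"]) auto
  qed
qed

text \<open>The part of Dini's theorem that is needed: along a convergent subsequence of points where the
\<open>n\<close>-th function is large, each fixed function stays large in the limit.\<close>
lemma uniformly_small_decreasing:
  fixes f :: "nat \<Rightarrow> 'x::metric_space \<Rightarrow> real"
  assumes K: "compact K" and cont: "\<And>n. continuous_on K (f n)"
    and dec: "\<And>m n x. x \<in> K \<Longrightarrow> m \<le> n \<Longrightarrow> f n x \<le> f m x"
    and lim: "\<And>x. x \<in> K \<Longrightarrow> (\<lambda>n. f n x) \<longlonglongrightarrow> 0" and e: "e > 0"
  shows "\<exists>n. \<forall>x\<in>K. f n x \<le> e"
proof (rule ccontr)
  assume "\<not> ?thesis"
  then have "\<forall>n. \<exists>x\<in>K. e < f n x" by (force simp: not_le)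
  then obtain x where x: "\<And>n. x n \<in> K" "\<And>n. e < f n (x n)" by metis
  then obtain l r where l: "l \<in> K" and r: "strict_mono r" and xl: "(x \<circ> r) \<longlonglongrightarrow> l"
    using K[unfolded compact_def, rule_format, of x] by blast
  obtain N where N: "f N l < e"
    using order_tendstoD(2)[OF lim[OF l] e] by (auto simp: eventually_sequentially)
  have "(\<lambda>n. f N ((x \<circ> r) n)) \<longlonglongrightarrow> f N l"
    using cont[of N] l xl x(1) by (auto simp: continuous_on_sequentially comp_def)
  moreover have "\<forall>\<^sub>F n in sequentially. e \<le> f N ((x \<circ> r) n)"
  proof (rule eventually_sequentiallyI)
    fix n assume "N \<le> n"
    then have "N \<le> r n" using seq_suble[OF r, of n] by linarith
    from dec[OF x(1) this, of "r n"] x(2)[of "r n"]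
    show "e \<le> f N ((x \<circ> r) n)" by simp
  qed
  ultimately have "e \<le> f N l" by (intro tendsto_lowerbound) auto
  then show False using N by simp
qed

text \<open>Substituting \<open>t = s * r\<close> turns the integral over \<open>[0, s]\<close> into \<open>s\<close> times an integral over the
fixed interval \<open>[0, 1]\<close>, where continuity in a parameter is available.\<close>
lemma continuous_on_indefinite_integral_param:
  fixes \<rho> :: "'x::metric_space \<Rightarrow> real \<Rightarrow> real"
  assumes \<rho>: "continuous_on (X \<times> {0..u}) (\<lambda>(x, t). \<rho> x t)"
  shows "continuous_on (X \<times> {0..u}) (\<lambda>(x, s). LINT t:{0..s}|lborel. \<rho> x t)"
proof -
  have "continuous_on ((X \<times> {0..u}) \<times> cbox 0 1) (\<lambda>(z, r). (\<lambda>(x, t). \<rho> x t) (fst z, r * snd z))"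
    unfolding case_prod_beta' fst_conv snd_conv
    by (rule continuous_on_compose2[OF \<rho>, unfolded case_prod_beta', where f = "\<lambda>y. (fst (fst y), snd y * snd (fst y))", simplified])
       (auto intro!: continuous_intros mult_left_le_one_le[THEN order_trans] simp: mult_le_one)
  from integral_continuous_on_param[OF this]
  have "continuous_on (X \<times> {0..u}) (\<lambda>z. snd z * integral (cbox 0 1) (\<lambda>r. \<rho> (fst z) (r * snd z)))"
    by (intro continuous_intros) (simp add: split_def)
  moreover have "snd z * integral (cbox 0 1) (\<lambda>r. \<rho> (fst z) (r * snd z)) =
      (\<lambda>(x, s). LINT t:{0..s}|lborel. \<rho> x t) z" if "z \<in> X \<times> {0..u}" for z
  proof -
    obtain x s where z: "z = (x, s)" "x \<in> X" "0 \<le> s" "s \<le> u" using \<open>z \<in> X \<times> {0..u}\<close> by (cases z) simp_all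
    have c: "continuous_on {0..s} (\<rho> x)"
      using continuous_on_section(1)[OF \<rho> z(2)] z by (auto intro: continuous_on_subset)
    show ?thesis
    proof (cases "s = 0")
      case True
      then show ?thesis using set_borel_integral_eq_integral(2)[OF borel_integrable_atLeastAtMost'[OF c]] by (simp add: z)
    next
      case False
      then have s: "s > 0" using z by simp
      have "((\<lambda>t. \<rho> x t) has_integral integral {0..s} (\<rho> x)) {0..s}"
        using integrable_continuous_interval[OF c] by (simp add: integrable_integral)
      from has_integral_stretch_real[OF this, of s] s
      have "((\<lambda>r. \<rho> x (s * r)) has_integral (integral {0..s} (\<rho> x) / s)) {0..1}"
        by simp
      then have "integral {0..1} (\<lambda>r. \<rho> x (r * s)) = integral {0..s} (\<rho> x) / s"
        by (simp add: integral_unique mult.commute)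
      then show ?thesis
        using s set_borel_integral_eq_integral(2)[OF borel_integrable_atLeastAtMost'[OF c]]
        by (simp add: z)
    qed
  qed
  ultimately show ?thesis by (simp cong: continuous_on_cong)
qed

text \<open>The time-dependent part of one decision epoch. A point \<open>x\<close> stands for an admissible action pair in
a fixed state; \<open>F x\<close> is the sojourn time distribution, \<open>\<rho> x\<close> the running cost and \<open>c x\<close> the immediate
cost.\<close>
locale sojourn_family =
  fixes X :: "'x::metric_space set" and F :: "'x \<Rightarrow> real \<Rightarrow> real" and \<rho> :: "'x \<Rightarrow> real \<Rightarrow> real"
    and c :: "'x \<Rightarrow> real" and u \<theta> :: real
  assumes compact_X: "compact X"
    and F_dist: "\<And>x. x \<in> X \<Longrightarrow> distribution_function (F x)"
    and F_zero: "\<And>x. x \<in> X \<Longrightarrow> F x 0 = 0"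
    and F_u: "\<And>x. x \<in> X \<Longrightarrow> F x u = 1"
    and u_pos: "u > 0" and \<theta>_pos: "\<theta> > 0"
    and feller: "\<And>v. v \<in> borel_measurable borel \<Longrightarrow> bounded (range v) \<Longrightarrow>
      continuous_on X (\<lambda>x. LINT s:{0..u}|interval_measure (F x). (v s :: real))"
    and \<rho>_cont: "continuous_on (X \<times> {0..u}) (\<lambda>(x, t). \<rho> x t)"
    and c_cont: "continuous_on X c"
begin

definition running_cost :: "'x \<Rightarrow> real \<Rightarrow> real" where
  "running_cost x s = (LINT t:{0..s}|lborel. \<rho> x t)"

definition weight :: "real \<Rightarrow> 'x \<Rightarrow> real" where
  "weight g x = exp (\<theta> * c x) *
     (LINT s:{0..u}|interval_measure (F x). exp (\<theta> * (running_cost x s - g * s)))"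

lemma running_cost_cont: "continuous_on (X \<times> {0..u}) (\<lambda>(x, s). running_cost x s)"
  unfolding running_cost_def by (rule continuous_on_indefinite_integral_param[OF \<rho>_cont])

lemma exp_cost_cont:
  "continuous_on (X \<times> {0..u}) (\<lambda>(x, s). exp (\<theta> * (running_cost x s - g * s)))"
  using running_cost_cont unfolding case_prod_beta' by (intro continuous_intros)

lemma real_distribution_F: "x \<in> X \<Longrightarrow> real_distribution (interval_measure (F x))"
  by (rule distribution_function_interval_measure(1)[OF F_dist])

lemma weight_cont: "continuous_on X (weight g)"
proof -
  have "continuous_on X (\<lambda>x. LINT s:{0..u}|interval_measure (F x).
      exp (\<theta> * (running_cost x s - g * s)))"
    by (rule continuous_on_integral_varying_measure[OF real_distribution_F exp_cost_cont feller])
  then show ?thesis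
    unfolding weight_def[abs_def] by (intro continuous_intros c_cont)
qed

lemma measure_initial:
  assumes x: "x \<in> X" and d: "0 \<le> d"
  shows "measure (interval_measure (F x)) {0..d} = F x d"
proof -
  interpret real_distribution "interval_measure (F x)" using real_distribution_F[OF x] .
  have cdf: "measure (interval_measure (F x)) {..y} = F x y" for y
    using distribution_function_interval_measure(2)[OF F_dist[OF x]] by (simp add: cdf_def fun_eq_iff)
  have "measure (interval_measure (F x)) {..<0} \<le> measure (interval_measure (F x)) {..0}"
    by (intro finite_measure_mono) auto
  then have "measure (interval_measure (F x)) {..<0} = 0"
    using cdf[of 0] F_zero[OF x] by (simp add: antisym)
  moreover have "measure (interval_measure (F x)) ({..<0} \<union> {0..d})
      = measure (interval_measure (F x)) {..<0} + measure (interval_measure (F x)) {0..d}"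
    by (intro finite_measure_Union) auto
  moreover have "{..<0} \<union> {0..d} = {..d}" using d by auto
  ultimately show ?thesis using cdf[of d] by simp
qed

lemma step_integral:
  assumes x: "x \<in> X" and d: "0 \<le> d" "d \<le> u"
  shows "set_integrable (interval_measure (F x)) {0..u} (\<lambda>s. \<alpha> * indicator {0..d} s + \<beta> :: real)"
    and "(LINT s:{0..u}|interval_measure (F x). \<alpha> * indicator {0..d} s + \<beta>) = \<alpha> * F x d + \<beta>"
proof -
  interpret real_distribution "interval_measure (F x)" using real_distribution_F[OF x] .
  have eq: "indicator {0..u} s *\<^sub>R (\<alpha> * indicator {0..d} s + \<beta>)
      = \<alpha> * indicator {0..d} s + \<beta> * indicator {0..u} s" for s :: real
    using d by (auto simp: indicator_def)
  have int: "integrable (interval_measure (F x)) (\<lambda>s. indicator {0..y} s :: real)" for y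
    by (intro integrable_const_bound[of _ 1]) auto
  show "set_integrable (interval_measure (F x)) {0..u} (\<lambda>s. \<alpha> * indicator {0..d} s + \<beta>)"
    unfolding set_integrable_def eq using int by simp
  show "(LINT s:{0..u}|interval_measure (F x). \<alpha> * indicator {0..d} s + \<beta>) = \<alpha> * F x d + \<beta>"
    unfolding set_lebesgue_integral_def eq
    using int measure_initial[OF x] d u_pos F_u[OF x] by simp
qed

lemma exp_cost_integrable:
  assumes x: "x \<in> X"
  shows "set_integrable (interval_measure (F x)) {0..u} (\<lambda>s. exp (\<theta> * (running_cost x s - g * s)))"
proof -
  interpret real_distribution "interval_measure (F x)" using real_distribution_F[OF x] .
  let ?f = "\<lambda>s. exp (\<theta> * (running_cost x s - g * s))"
  have cont: "continuous_on {0..u} ?f" by (rule continuous_on_section(1)[OF exp_cost_cont x])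
  then obtain M where "\<forall>y\<in>?f ` {0..u}. norm y \<le> M"
    using compact_imp_bounded[OF compact_continuous_image[OF cont compact_Icc]]
    unfolding bounded_iff by blast
  then have M: "norm (?f s) \<le> M" if "s \<in> {0..u}" for s using that by blast
  have "norm (indicator {0..u} s *\<^sub>R ?f s) \<le> max M 0" for s
    using M[of s] by (auto simp: indicator_def)
  moreover have "(\<lambda>s. indicator {0..u} s *\<^sub>R ?f s) \<in> borel_measurable borel"
    using set_measurable_continuous_on[OF _ cont] by (simp add: set_borel_measurable_def)
  ultimately show ?thesis
    unfolding set_integrable_def by (intro integrable_const_bound[of _ "max M 0"]) auto
qed

lemma weight_antimono:
  assumes x: "x \<in> X" and g: "g \<le> g'"
  shows "weight g' x \<le> weight g x"
  unfolding weight_def using g \<theta>_pos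
  by (intro mult_left_mono set_integral_mono exp_cost_integrable x) (auto intro: mult_right_mono)

text \<open>A sojourn lasts at most \<open>u\<close>, so a change of \<open>g\<close> alters the weight by at most a bounded factor. This is
what makes the logarithm of the principal eigenvalue Lipschitz in \<open>g\<close>.\<close>
lemma weight_ratio:
  assumes x: "x \<in> X" and g: "g \<le> g'"
  shows "weight g x \<le> exp (\<theta> * u * (g' - g)) * weight g' x"
proof -
  have "(LINT s:{0..u}|interval_measure (F x). exp (\<theta> * (running_cost x s - g * s)))
      \<le> (LINT s:{0..u}|interval_measure (F x).
            exp (\<theta> * u * (g' - g)) * exp (\<theta> * (running_cost x s - g' * s)))"
  proof (intro set_integral_mono exp_cost_integrable x set_integrable_mult_right)
    fix s assume s: "s \<in> {0..u}"
    have "(g' - g) * s \<le> (g' - g) * u" using s g by (intro mult_left_mono) auto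
    then have "\<theta> * ((g' - g) * s) \<le> \<theta> * ((g' - g) * u)"
      by (rule mult_left_mono) (use \<theta>_pos in simp)
    moreover have "\<theta> * (running_cost x s - g * s)
        = \<theta> * ((g' - g) * s) + \<theta> * (running_cost x s - g' * s)" by algebra
    ultimately have "\<theta> * (running_cost x s - g * s)
        \<le> \<theta> * u * (g' - g) + \<theta> * (running_cost x s - g' * s)"
      by (simp only: mult.assoc mult.commute[of u] add_le_cancel_right)
    then show "exp (\<theta> * (running_cost x s - g * s)) \<le>
        exp (\<theta> * u * (g' - g)) * exp (\<theta> * (running_cost x s - g' * s))"
      by (simp only: exp_add[symmetric] exp_le_cancel_iff)
  qed
  then show ?thesis
    unfolding weight_def by (simp add: mult.left_commute)
qed

lemma costs_bounded:
  obtains M where "\<And>x. x \<in> X \<Longrightarrow> \<bar>c x\<bar> \<le> M"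
    "\<And>x s. x \<in> X \<Longrightarrow> s \<in> {0..u} \<Longrightarrow> \<bar>running_cost x s\<bar> \<le> M"
proof -
  have "bounded (c ` X)"
    by (intro compact_imp_bounded compact_continuous_image c_cont compact_X)
  then obtain M1 where M1: "\<And>x. x \<in> X \<Longrightarrow> \<bar>c x\<bar> \<le> M1" by (auto simp: bounded_iff)
  have "bounded ((\<lambda>(x, s). running_cost x s) ` (X \<times> {0..u}))"
    by (intro compact_imp_bounded compact_continuous_image running_cost_cont compact_Times
        compact_X compact_Icc)
  then obtain M2 where M2: "\<forall>y\<in>(\<lambda>(x, s). running_cost x s) ` (X \<times> {0..u}). norm y \<le> M2"
    unfolding bounded_iff by blast
  show ?thesis
    by (rule that[of "max M1 M2"]) (use M1 M2 in \<open>fastforce simp: le_max_iff_disj\<close>)+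
qed

text \<open>Pointwise this is right continuity of \<open>F x\<close> at 0. The uniformity in \<open>x\<close> comes from Dini's argument,
since \<open>x \<mapsto> F x d\<close> is the integral of the indicator of \<open>[0, d]\<close> and hence continuous.\<close>
lemma no_mass_near_zero:
  assumes e: "e > 0"
  obtains d where "0 < d" "d \<le> u" "\<And>x. x \<in> X \<Longrightarrow> F x d \<le> e"
proof -
  have eq: "F x d = (LINT s:{0..u}|interval_measure (F x). indicator {0..d} s)"
    if "x \<in> X" "0 \<le> d" "d \<le> u" for x d
    using step_integral(2)[OF that, of 1 0] by simp
  have mono: "F x d \<le> F x d'" if "x \<in> X" "d \<le> d'" for x d d'
    using F_dist[OF that(1)] that(2) by (auto simp: distribution_function_def dest: monoD)
  let ?d = "\<lambda>n::nat. u / real (Suc n)"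
  have d: "0 < ?d n" "?d n \<le> u" for n
    using u_pos by (auto simp: field_simps)
  have "\<exists>n. \<forall>x\<in>X. F x (?d n) \<le> e"
  proof (rule uniformly_small_decreasing[OF compact_X _ _ _ e])
    fix n :: nat
    have "continuous_on X (\<lambda>x. LINT s:{0..u}|interval_measure (F x). (indicator {0..?d n} s :: real))"
      by (intro feller boundedI[of _ 1]) (auto simp: indicator_def)
    then show "continuous_on X (\<lambda>x. F x (?d n))"
      using eq d[of n] by (simp cong: continuous_on_cong)
  next
    fix m n :: nat and x assume "x \<in> X" "m \<le> n"
    then show "F x (?d n) \<le> F x (?d m)"
      using u_pos by (intro mono) (auto simp: frac_le)
  next
    fix x assume x: "x \<in> X"
    have "?d \<longlonglongrightarrow> 0"
      using LIMSEQ_Suc[OF lim_const_over_n[of u]] by simp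
    then have "filterlim ?d (at_right 0) sequentially"
      using d by (intro tendsto_imp_filterlim_at_right) auto
    moreover have "(F x \<longlongrightarrow> F x 0) (at_right 0)"
      using F_dist[OF x] by (auto simp: distribution_function_def continuous_within)
    ultimately show "(\<lambda>n. F x (?d n)) \<longlonglongrightarrow> 0"
      using filterlim_compose[of "F x" _ "at_right 0" ?d] F_zero[OF x] by metis
  qed
  then show ?thesis using that d by blast
qed

text \<open>A sojourn longer than \<open>d\<close> contributes at most the factor \<open>exp (- \<theta> g d)\<close>, and a shorter one has
probability at most \<open>e\<close>, uniformly in \<open>x\<close>.\<close>
lemma weight_le_one: "\<exists>g0. \<forall>g\<ge>g0. \<forall>x\<in>X. weight g x \<le> 1"
proof -
  obtain M where M: "\<And>x. x \<in> X \<Longrightarrow> \<bar>c x\<bar> \<le> M"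
    "\<And>x s. x \<in> X \<Longrightarrow> s \<in> {0..u} \<Longrightarrow> \<bar>running_cost x s\<bar> \<le> M" using costs_bounded by blast
  \<comment> \<open>twice e compensates the factor exp (2 * \<theta> * M) coming from the bounds on both costs\<close>
  define e where "e = exp (- (2 * \<theta> * M)) / 2"
  have e: "e > 0" by (simp add: e_def)
  obtain d where d: "0 < d" "d \<le> u" "\<And>x. x \<in> X \<Longrightarrow> F x d \<le> e"
    using no_mass_near_zero[OF e] by blast
  define g0 where "g0 = max 0 (- ln e / (\<theta> * d))"
  have "weight g x \<le> 1" if g: "g \<ge> g0" and x: "x \<in> X" for g x
  proof -
    have g_nonneg: "g \<ge> 0" using g by (simp add: g0_def)
    have "- ln e \<le> \<theta> * d * g"
      using g d(1) \<theta>_pos by (simp add: g0_def field_simps)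
    then have "exp (- (\<theta> * d * g)) \<le> exp (ln e)" by simp
    then have small: "exp (- (\<theta> * d * g)) \<le> e" using e by simp
    have "(LINT s:{0..u}|interval_measure (F x). exp (\<theta> * (running_cost x s - g * s)))
      \<le> (LINT s:{0..u}|interval_measure (F x).
          exp (\<theta> * M) * indicator {0..d} s + exp (\<theta> * M) * exp (- (\<theta> * d * g)))"
    proof (intro set_integral_mono exp_cost_integrable x step_integral(1))
      fix s assume s: "s \<in> {0..u}"
      have R: "\<theta> * running_cost x s \<le> \<theta> * M"
        using M(2)[OF x s] \<theta>_pos by (intro mult_left_mono) auto
      show "exp (\<theta> * (running_cost x s - g * s)) \<le>
          exp (\<theta> * M) * indicator {0..d} s + exp (\<theta> * M) * exp (- (\<theta> * d * g))"
      proof (cases "s \<le> d")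
        case True
        have "0 \<le> \<theta> * (g * s)" using s g_nonneg \<theta>_pos by simp
        then have "exp (\<theta> * (running_cost x s - g * s)) \<le> exp (\<theta> * M)"
          using R by (simp add: algebra_simps)
        then show ?thesis using True s by (simp add: add_increasing2)
      next
        case False
        have "\<theta> * g * d \<le> \<theta> * g * s" using False g_nonneg \<theta>_pos by (intro mult_left_mono) auto
        then have "\<theta> * (running_cost x s - g * s) \<le> \<theta> * M + - (\<theta> * d * g)"
          using R by (simp add: algebra_simps)
        then have "exp (\<theta> * (running_cost x s - g * s)) \<le> exp (\<theta> * M) * exp (- (\<theta> * d * g))"
          by (simp only: exp_add[symmetric] exp_le_cancel_iff)
        then show ?thesis using False s by simp
      qed
    qed (use d in auto)
    also have "\<dots> = exp (\<theta> * M) * (F x d + exp (- (\<theta> * d * g)))"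
      using step_integral(2)[OF x, of d] d by (simp add: distrib_left)
    also have "\<dots> \<le> exp (\<theta> * M) * (e + e)"
      using small d(3)[OF x] by (intro mult_left_mono add_mono) auto
    finally have "weight g x \<le> exp (\<theta> * c x) * (exp (\<theta> * M) * (e + e))"
      unfolding weight_def by (intro mult_left_mono) auto
    also have "\<dots> \<le> exp (\<theta> * M) * (exp (\<theta> * M) * (e + e))"
      using M(1)[OF x] \<theta>_pos e by (intro mult_right_mono) auto
    also have "\<dots> = 1"
      by (simp add: e_def exp_add[symmetric])
    finally show ?thesis .
  qed
  then show ?thesis by blast
qed

text \<open>For very negative \<open>g\<close> the factor \<open>exp (- \<theta> g s)\<close> is huge on sojourns longer than \<open>d\<close>, and these have
probability at least one half.\<close>
lemma weight_ge_one: "\<exists>g0. \<forall>g\<le>g0. \<forall>x\<in>X. 1 \<le> weight g x"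
proof -
  obtain M where M: "\<And>x. x \<in> X \<Longrightarrow> \<bar>c x\<bar> \<le> M"
    "\<And>x s. x \<in> X \<Longrightarrow> s \<in> {0..u} \<Longrightarrow> \<bar>running_cost x s\<bar> \<le> M" using costs_bounded by blast
  obtain d where d: "0 < d" "d \<le> u" "\<And>x. x \<in> X \<Longrightarrow> F x d \<le> 1 / 2"
    using no_mass_near_zero[of "1 / 2"] by auto
  define g0 where "g0 = min 0 (- (ln 2 + 2 * \<theta> * M) / (\<theta> * d))"
  have "1 \<le> weight g x" if g: "g \<le> g0" and x: "x \<in> X" for g x
  proof -
    have g_nonpos: "g \<le> 0" using g by (simp add: g0_def)
    have big: "ln 2 + 2 * \<theta> * M \<le> - (\<theta> * d * g)"
      using g d(1) \<theta>_pos by (simp add: g0_def field_simps)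
    define \<beta> where "\<beta> = exp (- (\<theta> * M)) * exp (- (\<theta> * d * g))"
    have \<beta>: "\<beta> > 0" by (simp add: \<beta>_def)
    have "1 = exp (- (\<theta> * M)) * (exp (- (\<theta> * M)) * exp (ln 2 + 2 * \<theta> * M) * (1 / 2))"
    proof -
      have "exp (- (\<theta> * M)) * (exp (- (\<theta> * M)) * exp (2 * \<theta> * M)) = 1"
        by (simp add: mult_exp_exp)
      then show ?thesis by (simp add: exp_add)
    qed
    also have "\<dots> \<le> exp (- (\<theta> * M)) * (\<beta> * (1 - F x d))"
      unfolding \<beta>_def using big d(3)[OF x] by (intro mult_left_mono mult_mono) auto
    also have "\<dots> \<le> exp (\<theta> * c x) * (\<beta> * (1 - F x d))"
    proof -
      have "\<theta> * (- M) \<le> \<theta> * c x" using M(1)[OF x] \<theta>_pos by (intro mult_left_mono) auto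
      then show ?thesis using \<beta> d(3)[OF x] by (intro mult_right_mono) auto
    qed
    also have "\<beta> * (1 - F x d) = (LINT s:{0..u}|interval_measure (F x). - \<beta> * indicator {0..d} s + \<beta>)"
      using step_integral(2)[OF x, of d "- \<beta>" \<beta>] d
      by (simp only: less_imp_le) (simp add: right_diff_distrib)
    also have "\<dots> \<le> (LINT s:{0..u}|interval_measure (F x). exp (\<theta> * (running_cost x s - g * s)))"
    proof (intro set_integral_mono exp_cost_integrable x step_integral(1))
      fix s assume s: "s \<in> {0..u}"
      have R: "\<theta> * (- M) \<le> \<theta> * running_cost x s"
        using M(2)[OF x s] \<theta>_pos by (intro mult_left_mono) auto
      show "- \<beta> * indicator {0..d} s + \<beta> \<le> exp (\<theta> * (running_cost x s - g * s))"
      proof (cases "s \<le> d")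
        case False
        have "\<theta> * (- g) * d \<le> \<theta> * (- g) * s"
          using False g_nonpos \<theta>_pos by (intro mult_left_mono) (auto simp: mult_nonneg_nonpos)
        then have "- (\<theta> * M) + - (\<theta> * d * g) \<le> \<theta> * (running_cost x s - g * s)"
          using R by (simp add: algebra_simps)
        then have "\<beta> \<le> exp (\<theta> * (running_cost x s - g * s))"
          unfolding \<beta>_def by (simp only: exp_add[symmetric] exp_le_cancel_iff)
        then show ?thesis using False by simp
      qed (use s in auto)
    qed (use d in auto)
    finally show ?thesis by (simp add: weight_def)
  qed
  then show ?thesis by blast
qed

lemma weight_pos:
  assumes x: "x \<in> X"
  shows "0 < weight g x"
proof -
  obtain g0 where g0: "\<And>g. g \<le> g0 \<Longrightarrow> 1 \<le> weight g x" using weight_ge_one x by blast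
  have "1 \<le> weight (min g g0) x" by (rule g0) simp
  also have "\<dots> \<le> exp (\<theta> * u * (g - min g g0)) * weight g x"
    by (rule weight_ratio[OF x]) simp
  finally have "0 < exp (\<theta> * u * (g - min g g0)) * weight g x" by simp
  then show ?thesis by (simp add: zero_less_mult_iff)
qed

end

section \<open>The Shapley operator of the semi-Markov game\<close>

lemma return_stationary:
  assumes "\<And>i. \<alpha> i \<in> D i" "\<And>i. D i \<subseteq> E" "\<And>i. D i \<in> sets borel"
  shows "(\<lambda>i. return (restrict_space borel E) (\<alpha> i)) \<in> stationary_policies E D"
proof -
  have mem: "\<alpha> i \<in> E" for i using assms by blast
  have "D i \<in> sets (restrict_space borel E)" for i
    using assms by (auto simp: sets_restrict_space intro!: image_eqI[of _ _ "D i"])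
  moreover have "return (restrict_space borel E) (\<alpha> i) \<in> space (prob_algebra (restrict_space borel E))" for i
    using mem by (auto simp: space_prob_algebra space_restrict_space intro!: prob_space_return)
  ultimately show ?thesis
    using assms(1) by (auto simp: stationary_policies_def measure_return)
qed

locale semi_markov_game =
  fixes A :: "'a::polish_space set" and B :: "'b::polish_space set"
    and DA :: "'s::finite \<Rightarrow> 'a set" and DB :: "'s \<Rightarrow> 'b set"
    and C :: "'s \<Rightarrow> 'a \<Rightarrow> 'b \<Rightarrow> real"
    and \<rho> :: "'s \<Rightarrow> 'a \<Rightarrow> 'b \<Rightarrow> real \<Rightarrow> real"
    and F :: "'s \<Rightarrow> 'a \<Rightarrow> 'b \<Rightarrow> real \<Rightarrow> real"
    and p :: "'s \<Rightarrow> 's \<Rightarrow> 'a \<Rightarrow> 'b \<Rightarrow> real"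
    and sbar \<theta> :: real
  assumes DA: "\<And>i. DA i \<subseteq> A" "\<And>i. DA i \<noteq> {}" "\<And>i. compact (DA i)"
    and DB: "\<And>i. DB i \<subseteq> B" "\<And>i. DB i \<noteq> {}" "\<And>i. compact (DB i)"
    and F_dist: "\<And>i a b. a \<in> DA i \<Longrightarrow> b \<in> DB i \<Longrightarrow> distribution_function (F i a b)"
    and F_zero: "\<And>i a b. a \<in> DA i \<Longrightarrow> b \<in> DB i \<Longrightarrow> F i a b 0 = 0"
    and F_sbar: "\<And>i a b. a \<in> DA i \<Longrightarrow> b \<in> DB i \<Longrightarrow> F i a b sbar = 1"
    and p_nonneg: "\<And>i j a b. a \<in> DA i \<Longrightarrow> b \<in> DB i \<Longrightarrow> 0 \<le> p i j a b"
    and p_sum: "\<And>i a b. a \<in> DA i \<Longrightarrow> b \<in> DB i \<Longrightarrow> (\<Sum>j\<in>UNIV. p i j a b) = 1"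
    and C_cont: "\<And>i. continuous_on (DA i \<times> DB i) (\<lambda>(a, b). C i a b)"
    and p_cont: "\<And>i j. continuous_on (DA i \<times> DB i) (\<lambda>(a, b). p i j a b)"
    and sbar_pos: "sbar > 0"
    and feller: "\<And>i u. u \<in> borel_measurable borel \<Longrightarrow> bounded (range u) \<Longrightarrow>
         continuous_on (DA i \<times> DB i)
           (\<lambda>(a, b). LINT s:{0..sbar}|interval_measure (F i a b). (u s :: real))"
    and \<rho>_cont: "\<And>i. continuous_on (DA i \<times> DB i \<times> {0..sbar}) (\<lambda>(a, b, s). \<rho> i a b s)"
    and irreducible: "\<And>\<phi>1 \<phi>2. \<phi>1 \<in> stationary_policies A DA \<Longrightarrow> \<phi>2 \<in> stationary_policies B DB \<Longrightarrow>
      irreducible_chain (embedded_transition DA DB p \<phi>1 \<phi>2)"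
    and \<theta>_pos: "\<theta> > 0"
begin

lemma compact_game: "compact_game (DA i) (DB i)"
  by unfold_locales (use DA DB in auto)

definition stage_weight :: "real \<Rightarrow> 's \<Rightarrow> 'a \<Rightarrow> 'b \<Rightarrow> real" where
  "stage_weight g i a b = exp (\<theta> * C i a b) *
     (LINT s:{0..sbar}|interval_measure (F i a b).
        exp (\<theta> * ((LINT t:{0..s}|lborel. \<rho> i a b t) - g * s)))"

lemma sojourn_family:
  "sojourn_family (DA i \<times> DB i) (\<lambda>(a, b). F i a b) (\<lambda>(a, b). \<rho> i a b) (\<lambda>(a, b). C i a b) sbar \<theta>"
proof
  show "compact (DA i \<times> DB i)" using DA DB by (intro compact_Times)
  show "continuous_on ((DA i \<times> DB i) \<times> {0..sbar}) (\<lambda>(x, t). (case x of (a, b) \<Rightarrow> \<rho> i a b) t)"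
  proof -
    have "continuous_on ((DA i \<times> DB i) \<times> {0..sbar})
        (\<lambda>y. (\<lambda>(a, b, s). \<rho> i a b s) (fst (fst y), snd (fst y), snd y))"
      by (intro continuous_on_compose2[OF \<rho>_cont[of i]] continuous_intros) auto
    then show ?thesis by (simp add: case_prod_beta')
  qed
  show "continuous_on (DA i \<times> DB i)
      (\<lambda>x. LINT s:{0..sbar}|interval_measure ((\<lambda>(a, b). F i a b) x). (v s :: real))"
    if "v \<in> borel_measurable borel" "bounded (range v)" for v
    using feller[OF that, of i] by (simp add: case_prod_beta')
qed (use F_dist F_zero F_sbar C_cont sbar_pos \<theta>_pos in auto)

lemma sojourn_weight:
  "sojourn_family.weight (\<lambda>(a, b). F i a b) (\<lambda>(a, b). \<rho> i a b) (\<lambda>(a, b). C i a b) sbar \<theta> g (a, b)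
     = stage_weight g i a b"
  by (simp add: sojourn_family.weight_def[OF sojourn_family]
      sojourn_family.running_cost_def[OF sojourn_family] stage_weight_def)

lemma payoff_stage_weight: "continuous_payoff (DA i) (DB i) (stage_weight g i)"
  using sojourn_family.weight_cont[OF sojourn_family, of i g]
  by (simp add: continuous_payoff_def sojourn_weight[symmetric])

lemma stage_weight_pos: "a \<in> DA i \<Longrightarrow> b \<in> DB i \<Longrightarrow> 0 < stage_weight g i a b"
  using sojourn_family.weight_pos[OF sojourn_family, of "(a, b)" i g] by (simp add: sojourn_weight)

lemma stage_weight_antimono:
  "a \<in> DA i \<Longrightarrow> b \<in> DB i \<Longrightarrow> g \<le> g' \<Longrightarrow> stage_weight g' i a b \<le> stage_weight g i a b"
  using sojourn_family.weight_antimono[OF sojourn_family, of "(a, b)" i g g']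
  by (simp add: sojourn_weight)

lemma stage_weight_ratio:
  "a \<in> DA i \<Longrightarrow> b \<in> DB i \<Longrightarrow> g \<le> g' \<Longrightarrow>
    stage_weight g i a b \<le> exp (\<theta> * sbar * (g' - g)) * stage_weight g' i a b"
  using sojourn_family.weight_ratio[OF sojourn_family, of "(a, b)" i g g']
  by (simp add: sojourn_weight)

lemma stage_weight_le_one:
  obtains g where "\<And>i a b. a \<in> DA i \<Longrightarrow> b \<in> DB i \<Longrightarrow> stage_weight g i a b \<le> 1"
proof -
  have "\<forall>i. \<exists>g0. \<forall>g\<ge>g0. \<forall>x\<in>DA i \<times> DB i. stage_weight g i (fst x) (snd x) \<le> 1"
    using sojourn_family.weight_le_one[OF sojourn_family] by (auto simp: sojourn_weight)
  then obtain g0 where g0: "\<And>i g a b. g0 i \<le> g \<Longrightarrow> a \<in> DA i \<Longrightarrow> b \<in> DB i \<Longrightarrow> stage_weight g i a b \<le> 1"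
    by (metis SigmaI fst_conv snd_conv)
  show ?thesis by (rule that[of "Max (range g0)"]) (auto intro!: g0)
qed

lemma stage_weight_ge_one:
  obtains g where "\<And>i a b. a \<in> DA i \<Longrightarrow> b \<in> DB i \<Longrightarrow> 1 \<le> stage_weight g i a b"
proof -
  have "\<forall>i. \<exists>g0. \<forall>g\<le>g0. \<forall>x\<in>DA i \<times> DB i. 1 \<le> stage_weight g i (fst x) (snd x)"
    using sojourn_family.weight_ge_one[OF sojourn_family] by (auto simp: sojourn_weight)
  then obtain g0 where g0: "\<And>i g a b. g \<le> g0 i \<Longrightarrow> a \<in> DA i \<Longrightarrow> b \<in> DB i \<Longrightarrow> 1 \<le> stage_weight g i a b"
    by (metis SigmaI fst_conv snd_conv)
  show ?thesis by (rule that[of "Min (range g0)"]) (auto intro!: g0)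
qed

definition continuation :: "real ^ 's \<Rightarrow> 's \<Rightarrow> 'a \<Rightarrow> 'b \<Rightarrow> real" where
  "continuation x i a b = (\<Sum>j\<in>UNIV. x $ j * p i j a b)"

text \<open>The right-hand side of the optimality equation in the unknown \<open>x $ j = exp (\<theta> * h j)\<close>. It is
positively homogeneous, so the equation asks for an eigenvector with eigenvalue 1.\<close>
definition shapley :: "real \<Rightarrow> real ^ 's \<Rightarrow> real ^ 's" where
  "shapley g x = (\<chi> i. game_value (DA i) (DB i) (\<lambda>a b. stage_weight g i a b * continuation x i a b))"

lemma payoff_stage: "continuous_payoff (DA i) (DB i) (\<lambda>a b. stage_weight g i a b * continuation x i a b)"
  using payoff_stage_weight[of i g] p_cont[of i]
  unfolding continuous_payoff_def continuation_def case_prod_beta' by (intro continuous_intros)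

lemma continuation_mono:
  assumes "a \<in> DA i" "b \<in> DB i" and "\<And>j. x $ j \<le> t * y $ j"
  shows "continuation x i a b \<le> t * continuation y i a b"
proof -
  have "continuation x i a b \<le> (\<Sum>j\<in>UNIV. (t * y $ j) * p i j a b)"
    unfolding continuation_def using assms p_nonneg by (intro sum_mono mult_right_mono) auto
  then show ?thesis by (simp add: continuation_def sum_distrib_left mult.assoc)
qed

lemma continuation_nonneg:
  "a \<in> DA i \<Longrightarrow> b \<in> DB i \<Longrightarrow> (\<And>j. 0 \<le> x $ j) \<Longrightarrow> 0 \<le> continuation x i a b"
  unfolding continuation_def using p_nonneg by (intro sum_nonneg mult_nonneg_nonneg) auto

lemma continuation_pos:
  assumes ab: "a \<in> DA i" "b \<in> DB i" and x: "\<And>j. 0 \<le> x $ j" and j: "0 < x $ j" "p i j a b \<noteq> 0"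
  shows "0 < continuation x i a b"
  unfolding continuation_def
proof (rule sum_pos2[of _ j])
  show "0 < x $ j * p i j a b" using j p_nonneg[OF ab, of j] by simp
qed (use x p_nonneg[OF ab] in auto)

lemma shapley_nonneg:
  assumes "\<And>j. 0 \<le> x $ j"
  shows "0 \<le> shapley g x $ i"
proof -
  interpret compact_game "DA i" "DB i" by (rule compact_game)
  have "game_value (DA i) (DB i) (\<lambda>_ _. 0) \<le> 1 * shapley g x $ i + 0"
    unfolding shapley_def vec_lambda_beta
    using continuation_nonneg[OF _ _ assms] less_imp_le[OF stage_weight_pos]
    by (intro game_value_affine_mono payoff_const payoff_stage) auto
  then show ?thesis by (simp add: game_value_const)
qed

lemma shapley_pos:
  assumes x: "\<And>j. 0 < x $ j"
  shows "0 < shapley g x $ i"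
proof -
  interpret compact_game "DA i" "DB i" by (rule compact_game)
  obtain b where b: "b \<in> DB i" using DB by blast
  have pos: "0 < stage_weight g i a b * continuation x i a b" if a: "a \<in> DA i" for a
  proof -
    obtain j where "p i j a b \<noteq> 0"
      using p_sum[OF a b] by (metis sum.neutral zero_neq_one)
    then show ?thesis
      using stage_weight_pos[OF a b] continuation_pos[OF a b _ x] x
      by (intro mult_pos_pos) (auto intro: less_imp_le)
  qed
  show ?thesis
    unfolding shapley_def vec_lambda_beta by (rule game_value_pos[OF payoff_stage b pos])
qed

lemma shapley_lipschitz:
  obtains L where "0 \<le> L" "\<And>x y. shapley g x $ i \<le> shapley g y $ i + L * norm (x - y)"
proof -
  interpret compact_game "DA i" "DB i" by (rule compact_game)
  obtain M where M: "\<And>a b. a \<in> DA i \<Longrightarrow> b \<in> DB i \<Longrightarrow> \<bar>stage_weight g i a b\<bar> \<le> M"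
    using payoff_bounded[OF payoff_stage_weight] by blast
  then have M_nonneg: "0 \<le> M" using DA(2)[of i] DB(2)[of i] by (meson abs_ge_zero ex_in_conv order_trans)
  have "shapley g x $ i \<le> 1 * shapley g y $ i + M * norm (x - y)" for x y
    unfolding shapley_def vec_lambda_beta
  proof (intro game_value_affine_mono payoff_stage)
    fix a b assume ab: "a \<in> DA i" "b \<in> DB i"
    have "continuation x i a b - continuation y i a b = (\<Sum>j\<in>UNIV. (x - y) $ j * p i j a b)"
      by (simp add: continuation_def sum_subtractf left_diff_distrib)
    also have "\<dots> \<le> (\<Sum>j\<in>UNIV. norm (x - y) * p i j a b)"
      using p_nonneg[OF ab] component_le_norm_cart[of "x - y"]
      by (intro sum_mono mult_right_mono) (auto simp: abs_le_iff simp del: vector_minus_component)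
    also have "\<dots> = norm (x - y)"
      using p_sum[OF ab] by (simp flip: sum_distrib_left)
    finally have "stage_weight g i a b * (continuation x i a b - continuation y i a b)
        \<le> stage_weight g i a b * norm (x - y)"
      using stage_weight_pos[OF ab] by (intro mult_left_mono) (auto intro: less_imp_le)
    also have "\<dots> \<le> M * norm (x - y)"
      using M[OF ab] by (intro mult_right_mono) auto
    finally show "stage_weight g i a b * continuation x i a b
        \<le> 1 * (stage_weight g i a b * continuation y i a b) + M * norm (x - y)"
      by (simp add: algebra_simps)
  qed simp
  then show ?thesis using that M_nonneg by auto
qed

lemma shapley_cont: "continuous_on S (shapley g)"
proof -
  have "continuous_on S (\<lambda>x. shapley g x $ i)" for i
  proof -
    obtain L where L: "0 \<le> L" "\<And>x y. shapley g x $ i \<le> shapley g y $ i + L * norm (x - y)"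
      using shapley_lipschitz by blast
    have "L-lipschitz_on S (\<lambda>x. shapley g x $ i)"
    proof (rule lipschitz_onI)
      fix x y
      show "dist (shapley g x $ i) (shapley g y $ i) \<le> L * dist x y"
        using L(2)[of x y] L(2)[of y x] by (simp add: dist_norm norm_minus_commute abs_le_iff)
    qed (rule L(1))
    then show ?thesis by (rule lipschitz_on_continuous_on)
  qed
  then have "continuous_on S (\<lambda>x. \<chi> i. shapley g x $ i)"
    by (rule continuous_on_vec_lambda)
  then show ?thesis by simp
qed

lemma embedded_transition_return:
  assumes \<alpha>: "\<And>i. \<alpha> i \<in> DA i" and \<beta>: "\<And>i. \<beta> i \<in> DB i"
  shows "embedded_transition DA DB p (\<lambda>i. return (restrict_space borel A) (\<alpha> i))
      (\<lambda>i. return (restrict_space borel B) (\<beta> i)) i j = p i j (\<alpha> i) (\<beta> i)"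
proof -
  have inner: "(LINT b:DB i|return (restrict_space borel B) (\<beta> i). p i j a b) = p i j a (\<beta> i)"
    if a: "a \<in> DA i" for a
  proof -
    have "continuous_on (DB i) (p i j a)" by (rule continuous_on_section(1)[OF p_cont a])
    then have "(\<lambda>b. indicator (DB i) b *\<^sub>R p i j a b) \<in> borel_measurable borel"
      using set_measurable_continuous_on[of "DB i" "p i j a"] DB(3)[of i]
      by (simp add: set_borel_measurable_def borel_compact)
    then show ?thesis
      unfolding set_lebesgue_integral_def using \<beta>[of i] DB(1)[of i]
      by (subst integral_return) (auto simp: space_restrict_space intro!: measurable_restrict_space1)
  qed
  have "continuous_on (DA i) (\<lambda>a. p i j a (\<beta> i))"
    by (rule continuous_on_section(2)[OF p_cont \<beta>])
  then have meas: "(\<lambda>a. indicator (DA i) a *\<^sub>R p i j a (\<beta> i)) \<in> borel_measurable borel"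
    using set_measurable_continuous_on[of "DA i" "\<lambda>a. p i j a (\<beta> i)"] DA(3)[of i]
    by (simp add: set_borel_measurable_def borel_compact)
  have "indicator (DA i) a *\<^sub>R (LINT b:DB i|return (restrict_space borel B) (\<beta> i). p i j a b)
      = indicator (DA i) a *\<^sub>R p i j a (\<beta> i)" for a
    using inner by (auto simp: indicator_def)
  then have "embedded_transition DA DB p (\<lambda>i. return (restrict_space borel A) (\<alpha> i))
      (\<lambda>i. return (restrict_space borel B) (\<beta> i)) i j
      = (LINT a:DA i|return (restrict_space borel A) (\<alpha> i). p i j a (\<beta> i))"
    unfolding embedded_transition_def set_lebesgue_integral_def[of _ "DA i"]
    by (simp only:)
  also have "\<dots> = p i j (\<alpha> i) (\<beta> i)"
    unfolding set_lebesgue_integral_def using \<alpha>[of i] DA(1)[of i] meas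
    by (subst integral_return) (auto simp: space_restrict_space intro!: measurable_restrict_space1)
  finally show ?thesis .
qed

text \<open>Pure stationary policies suffice: the embedded chain of a pair of pure policies has the transition
matrix \<open>p k l (\<alpha> k) (\<beta> k)\<close>, and an irreducible chain leaves every nonempty proper set of states.\<close>
lemma no_closed_class:
  assumes \<alpha>: "\<And>i. \<alpha> i \<in> DA i" and \<beta>: "\<And>i. \<beta> i \<in> DB i" and Z: "i \<in> Z" "j \<notin> Z"
  obtains k l where "k \<in> Z" "l \<notin> Z" "p k l (\<alpha> k) (\<beta> k) \<noteq> 0"
proof (rule ccontr)
  note escape = that
  define P where "P = embedded_transition DA DB p (\<lambda>i. return (restrict_space borel A) (\<alpha> i))
      (\<lambda>i. return (restrict_space borel B) (\<beta> i))"
  assume "\<not> thesis"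
  then have "P k l = 0" if kl: "k \<in> Z" "l \<notin> Z" for k l
    using escape[OF kl] \<open>\<not> thesis\<close> unfolding P_def embedded_transition_return[OF \<alpha> \<beta>] by blast
  then have "n_step_transition P n i j = 0" for n
    using Z by (rule closed_class_not_left)
  moreover have "irreducible_chain P"
    unfolding P_def using DA DB \<alpha> \<beta>
    by (intro irreducible return_stationary) (auto intro: borel_compact)
  ultimately show False unfolding irreducible_chain_def by (metis less_irrefl)
qed

text \<open>If the operator left all zero coordinates of \<open>x\<close> nonpositive, then against any pure actions of the
maximizer the minimizer could answer, in each such state, by an action under which the chain
never moves to a state where \<open>x\<close> is positive. The zero set would be closed for a pair of pure
stationary policies, against irreducibility.\<close>
lemma shapley_escape:
  assumes x: "x \<in> std_simplex" and "\<exists>i. x $ i = 0"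
  shows "\<exists>i. x $ i = 0 \<and> 0 < shapley g x $ i"
proof (rule ccontr)
  assume contra: "\<not> ?thesis"
  have x_nonneg: "\<And>j. 0 \<le> x $ j" using x by (simp add: std_simplex_def)
  \<comment> \<open>an arbitrary pure policy of the maximizer\<close>
  define \<beta> where "\<beta> i = (SOME b. b \<in> DB i)" for i
  have \<beta>: "\<beta> i \<in> DB i" for i
    unfolding \<beta>_def using DB(2)[of i] by (simp add: some_in_eq)
  have "\<exists>a\<in>DA i. x $ i = 0 \<longrightarrow> (\<forall>j. x $ j \<noteq> 0 \<longrightarrow> p i j a (\<beta> i) = 0)" for i
  proof (cases "x $ i = 0")
    case True
    interpret compact_game "DA i" "DB i" by (rule compact_game)
    have "\<not> 0 < shapley g x $ i" using contra True by blast
    then obtain a where a: "a \<in> DA i" "\<not> 0 < stage_weight g i a (\<beta> i) * continuation x i a (\<beta> i)"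
      using game_value_pos[OF payoff_stage \<beta>] unfolding shapley_def vec_lambda_beta by blast
    have "p i j a (\<beta> i) = 0" if "x $ j \<noteq> 0" for j
    proof (rule ccontr)
      assume "p i j a (\<beta> i) \<noteq> 0"
      then have "0 < continuation x i a (\<beta> i)"
        using x_nonneg[of j] that by (intro continuation_pos[OF a(1) \<beta> x_nonneg]) auto
      then show False using a stage_weight_pos[OF a(1) \<beta>] by (simp add: mult_pos_pos)
    qed
    then show ?thesis using a(1) by blast
  qed (use DA(2) in blast)
  then obtain \<alpha> where \<alpha>: "\<And>i. \<alpha> i \<in> DA i"
      "\<And>i j. x $ i = 0 \<Longrightarrow> x $ j \<noteq> 0 \<Longrightarrow> p i j (\<alpha> i) (\<beta> i) = 0"
    by metis
  obtain i where i: "i \<in> {i. x $ i = 0}" using assms(2) by blast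
  obtain j where j: "j \<notin> {i. x $ i = 0}"
    using x by (auto simp: std_simplex_def) (metis sum.neutral zero_neq_one)
  show False
    using no_closed_class[OF \<alpha>(1) \<beta> i j] \<alpha>(2) by blast
qed

lemma shapley_eigenvector:
  obtains \<kappa> x where "0 < \<kappa>" "\<And>i. 0 < x $ i" "shapley g x = \<kappa> *\<^sub>R x"
proof (rule positive_eigenvector[of "shapley g"])
  show "0 \<le> shapley g x $ i" if "x \<in> std_simplex" for x i
    using that by (intro shapley_nonneg) (simp add: std_simplex_def)
  show "0 < shapley g x $ i" if "\<And>j. 0 < x $ j" for x i
    by (rule shapley_pos[OF that])
  show "\<exists>i. x $ i = 0 \<and> 0 < shapley g x $ i" if "x \<in> std_simplex" "\<exists>i. x $ i = 0" for x
    by (rule shapley_escape[OF that])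
qed (rule shapley_cont, rule that)

lemma shapley_scaled_mono:
  assumes c: "0 < c" and t: "0 < t" and y: "\<And>j. 0 \<le> y $ j" and le: "\<And>j. x $ j \<le> t * y $ j"
    and weights: "\<And>a b. a \<in> DA i \<Longrightarrow> b \<in> DB i \<Longrightarrow> stage_weight g i a b \<le> c * stage_weight g' i a b"
  shows "shapley g x $ i \<le> c * t * shapley g' y $ i"
proof -
  interpret compact_game "DA i" "DB i" by (rule compact_game)
  have "shapley g x $ i \<le> (c * t) * shapley g' y $ i + 0"
    unfolding shapley_def vec_lambda_beta
  proof (intro game_value_affine_mono payoff_stage)
    fix a b assume ab: "a \<in> DA i" "b \<in> DB i"
    have "stage_weight g i a b * continuation x i a b
        \<le> stage_weight g i a b * (t * continuation y i a b)"
      using stage_weight_pos[OF ab] continuation_mono[OF ab le]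
      by (intro mult_left_mono) (auto intro: less_imp_le)
    also have "\<dots> \<le> c * stage_weight g' i a b * (t * continuation y i a b)"
      using t continuation_nonneg[OF ab y] by (intro mult_right_mono weights ab) auto
    finally show "stage_weight g i a b * continuation x i a b
        \<le> (c * t) * (stage_weight g' i a b * continuation y i a b) + 0"
      by (simp add: mult_ac)
  qed (use c t in simp)
  then show ?thesis by simp
qed

lemma eigenvalue_le:
  assumes x: "\<And>i. 0 < x $ i" "shapley g x = \<kappa> *\<^sub>R x"
    and y: "\<And>i. 0 < y $ i" "shapley g' y = \<mu> *\<^sub>R y" and c: "0 < c"
    and weights: "\<And>i a b. a \<in> DA i \<Longrightarrow> b \<in> DB i \<Longrightarrow> stage_weight g' i a b \<le> c * stage_weight g i a b"
  shows "\<mu> \<le> c * \<kappa>"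
  by (rule eigenvalue_comparison[where T = "shapley g" and S = "shapley g'", OF x y])
     (intro shapley_scaled_mono c weights less_imp_le[OF x(1)])

lemma continuation_one: "a \<in> DA i \<Longrightarrow> b \<in> DB i \<Longrightarrow> continuation 1 i a b = 1"
  using p_sum by (simp add: continuation_def)

text \<open>Comparison with the identity, for which the vector with all entries 1 is an eigenvector.\<close>
lemma eigenvalue_le_one:
  assumes x: "\<And>i. 0 < x $ i" "shapley g x = \<kappa> *\<^sub>R x"
    and le: "\<And>i a b. a \<in> DA i \<Longrightarrow> b \<in> DB i \<Longrightarrow> stage_weight g i a b \<le> 1"
  shows "\<kappa> \<le> 1"
proof -
  have "\<kappa> \<le> 1 * 1"
  proof (rule eigenvalue_comparison[where T = id and x = 1 and S = "shapley g", OF _ _ x])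
    fix t i assume t: "0 < t" and xt: "\<And>j. x $ j \<le> t * (1 :: real ^ 's) $ j"
    interpret compact_game "DA i" "DB i" by (rule compact_game)
    have "shapley g x $ i \<le> 1 * game_value (DA i) (DB i) (\<lambda>_ _. t) + 0"
      unfolding shapley_def vec_lambda_beta
    proof (intro game_value_affine_mono payoff_stage payoff_const)
      fix a b assume ab: "a \<in> DA i" "b \<in> DB i"
      have "stage_weight g i a b * continuation x i a b \<le> continuation x i a b"
        using le[OF ab] continuation_nonneg[OF ab less_imp_le[OF x(1)]] by (intro mult_left_le_one_le)
          (auto intro: less_imp_le stage_weight_pos ab)
      also have "\<dots> \<le> t"
        using continuation_mono[OF ab xt] continuation_one[OF ab] by simp
      finally show "stage_weight g i a b * continuation x i a b \<le> 1 * t + 0" by simp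
    qed simp
    then show "shapley g x $ i \<le> 1 * t * id (1 :: real ^ 's) $ i"
      by (simp add: game_value_const)
  qed simp_all
  then show ?thesis by simp
qed

lemma eigenvalue_ge_one:
  assumes x: "\<And>i. 0 < x $ i" "shapley g x = \<kappa> *\<^sub>R x"
    and ge: "\<And>i a b. a \<in> DA i \<Longrightarrow> b \<in> DB i \<Longrightarrow> 1 \<le> stage_weight g i a b"
  shows "1 \<le> \<kappa>"
proof -
  have "1 \<le> 1 * \<kappa>"
  proof (rule eigenvalue_comparison[where T = "shapley g" and S = id and y = 1, OF x])
    fix t i assume t: "0 < t" and xt: "\<And>j. (1 :: real ^ 's) $ j \<le> t * x $ j"
    interpret compact_game "DA i" "DB i" by (rule compact_game)
    have "game_value (DA i) (DB i) (\<lambda>_ _. 1) \<le> t * shapley g x $ i + 0"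
      unfolding shapley_def vec_lambda_beta
    proof (intro game_value_affine_mono payoff_stage payoff_const t)
      fix a b assume ab: "a \<in> DA i" "b \<in> DB i"
      have "1 \<le> t * continuation x i a b"
        using continuation_mono[OF ab xt] continuation_one[OF ab] by simp
      also have "\<dots> \<le> t * (stage_weight g i a b * continuation x i a b)"
        using t mult_right_mono[OF ge[OF ab] continuation_nonneg[OF ab less_imp_le[OF x(1)]]] by simp
      finally show "1 \<le> t * (stage_weight g i a b * continuation x i a b) + 0" by simp
    qed
    then show "id (1 :: real ^ 's) $ i \<le> 1 * t * shapley g x $ i"
      by (simp add: game_value_const)
  qed simp_all
  then show ?thesis by simp
qed

text \<open>The logarithm of the principal eigenvalue is a Lipschitz function of \<open>g\<close> that is nonnegative
somewhere and nonpositive somewhere, so it vanishes somewhere.\<close>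
lemma unit_eigenvalue:
  obtains g x where "\<And>i. 0 < x $ i" "shapley g x = x"
proof -
  obtain ev X where ev: "\<And>g. 0 < ev g" and X: "\<And>g i. 0 < X g $ i"
      and eig: "\<And>g. shapley g (X g) = ev g *\<^sub>R X g"
  proof -
    have "\<exists>\<kappa> x. 0 < \<kappa> \<and> (\<forall>i. 0 < x $ i) \<and> shapley g x = \<kappa> *\<^sub>R x" for g
      by (rule shapley_eigenvector[of g]) blast
    then show ?thesis using that by metis
  qed
  note cmp = eigenvalue_le[OF X eig X eig]
  have lip: "\<bar>ln (ev g') - ln (ev g)\<bar> \<le> \<theta> * sbar * \<bar>g' - g\<bar>" if "g \<le> g'" for g g'
  proof -
    have "ev g' \<le> 1 * ev g"
      by (rule cmp) (auto intro: stage_weight_antimono that)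
    moreover have "ev g \<le> exp (\<theta> * sbar * (g' - g)) * ev g'"
      by (rule cmp) (auto intro: stage_weight_ratio that)
    then have "ln (ev g) \<le> ln (exp (\<theta> * sbar * (g' - g)) * ev g')"
      using ev[of g] ev[of g'] by (simp only: ln_le_cancel_iff mult_pos_pos exp_gt_zero)
    then have "ln (ev g) \<le> \<theta> * sbar * (g' - g) + ln (ev g')"
      using ev[of g'] by (simp add: ln_mult)
    ultimately show ?thesis
      using ev[of g] ev[of g'] that by (simp add: abs_le_iff)
  qed
  have "(\<theta> * sbar)-lipschitz_on UNIV (\<lambda>g. ln (ev g))"
  proof (rule lipschitz_onI)
    show "dist (ln (ev g)) (ln (ev g')) \<le> \<theta> * sbar * dist g g'" for g g'
      using lip[of g g'] lip[of g' g] by (cases "g \<le> g'") (auto simp: dist_real_def abs_minus_commute)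
  qed (use \<theta>_pos sbar_pos in simp)
  then have cont: "continuous_on UNIV (\<lambda>g. ln (ev g))"
    by (rule lipschitz_on_continuous_on)
  obtain g1 where "\<And>i a b. a \<in> DA i \<Longrightarrow> b \<in> DB i \<Longrightarrow> 1 \<le> stage_weight g1 i a b"
    using stage_weight_ge_one by blast
  then have lo: "0 \<le> ln (ev g1)"
    using eigenvalue_ge_one[OF X eig] by simp
  obtain g2 where "\<And>i a b. a \<in> DA i \<Longrightarrow> b \<in> DB i \<Longrightarrow> stage_weight g2 i a b \<le> 1"
    using stage_weight_le_one by blast
  then have hi: "ln (ev g2) \<le> 0"
    using eigenvalue_le_one[OF X eig] ev[of g2] by simp
  have conn: "connected (range (\<lambda>g. ln (ev g)))"
    by (rule connected_continuous_image[OF cont connected_UNIV])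
  have "0 \<in> range (\<lambda>g. ln (ev g))"
    by (rule connectedD_interval[OF conn _ _ hi lo]) simp_all
  then obtain g where "ln (ev g) = 0" by (metis imageE)
  then have "ev g = 1" using ev[of g] by simp
  then show ?thesis using that[of "X g" g] X eig[of g] by simp
qed

end

theorem theorem3:
  fixes A :: "'a::polish_space set" and B :: "'b::polish_space set"
    and DA :: "'s::finite \<Rightarrow> 'a set" and DB :: "'s \<Rightarrow> 'b set"
    and C :: "'s \<Rightarrow> 'a \<Rightarrow> 'b \<Rightarrow> real"
    and \<rho> :: "'s \<Rightarrow> 'a \<Rightarrow> 'b \<Rightarrow> real \<Rightarrow> real"
    and F :: "'s \<Rightarrow> 'a \<Rightarrow> 'b \<Rightarrow> real \<Rightarrow> real"
    and p :: "'s \<Rightarrow> 's \<Rightarrow> 'a \<Rightarrow> 'b \<Rightarrow> real"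
    and sbar \<theta> :: real
  assumes A_borel: "A \<in> sets borel" and B_borel: "B \<in> sets borel"
    and DA: "\<And>i. DA i \<in> sets borel" "\<And>i. DA i \<subseteq> A" "\<And>i. DA i \<noteq> {}"
    and DB: "\<And>i. DB i \<in> sets borel" "\<And>i. DB i \<subseteq> B" "\<And>i. DB i \<noteq> {}"
    and F_dist: "\<And>i a b. a \<in> DA i \<Longrightarrow> b \<in> DB i \<Longrightarrow> distribution_function (F i a b)"
    and F_zero: "\<And>i a b. a \<in> DA i \<Longrightarrow> b \<in> DB i \<Longrightarrow> F i a b 0 = 0"
    and p_nonneg: "\<And>i j a b. a \<in> DA i \<Longrightarrow> b \<in> DB i \<Longrightarrow> 0 \<le> p i j a b"
    and p_sum: "\<And>i a b. a \<in> DA i \<Longrightarrow> b \<in> DB i \<Longrightarrow> (\<Sum>j\<in>UNIV. p i j a b) = 1"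
    and assm1_i: "\<And>i. compact (DA i)" "\<And>i. compact (DB i)"
    and assm1_ii: "\<And>i. continuous_on (DA i \<times> DB i) (\<lambda>(a, b). C i a b)"
      "\<And>i j. continuous_on (DA i \<times> DB i) (\<lambda>(a, b). p i j a b)"
    and assm1_iii: "sbar > 0"
      "\<And>i a b. a \<in> DA i \<Longrightarrow> b \<in> DB i \<Longrightarrow> F i a b sbar = 1"
      "\<And>i u. u \<in> borel_measurable borel \<Longrightarrow> bounded (range u) \<Longrightarrow>
         continuous_on (DA i \<times> DB i)
           (\<lambda>(a, b). LINT s:{0..sbar}|interval_measure (F i a b). (u s :: real))"
    and assm1_iv: "\<And>i. continuous_on (DA i \<times> DB i \<times> {0..sbar}) (\<lambda>(a, b, s). \<rho> i a b s)"
    and assm2: "\<And>\<phi>1 \<phi>2. \<phi>1 \<in> stationary_policies A DA \<Longrightarrow> \<phi>2 \<in> stationary_policies B DB \<Longrightarrow>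
      irreducible_chain (embedded_transition DA DB p \<phi>1 \<phi>2)"
    and theta: "\<theta> > 0"
  shows "\<exists>(g::real) (h::'s \<Rightarrow> real). \<forall>i.
    ereal (exp (\<theta> * h i)) =
      (SUP \<phi>\<in>prob_measures (DB i). INF \<psi>\<in>prob_measures (DA i).
        ereal (LINT a|\<psi>. LINT b|\<phi>.
          exp (\<theta> * C i a b) *
          (LINT s:{0..sbar}|interval_measure (F i a b).
             exp (\<theta> * ((LINT t:{0..s}|lborel. \<rho> i a b t) - g * s))) *
          (\<Sum>j\<in>UNIV. exp (\<theta> * h j) * p i j a b)))"
proof -
  interpret semi_markov_game A B DA DB C \<rho> F p sbar \<theta>
    by unfold_locales
      (fact DA DB assm1_i F_dist F_zero p_nonneg p_sum assm1_ii assm1_iii assm1_iv assm2 theta)+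
  obtain g x where x: "\<And>i. 0 < x $ i" "shapley g x = x"
    using unit_eigenvalue by blast
  define h where "h i = ln (x $ i) / \<theta>" for i
  have exp_h: "exp (\<theta> * h i) = x $ i" for i
    using theta x(1)[of i] by (simp add: h_def)
  show ?thesis
  proof (intro exI allI)
    fix i
    interpret game: compact_game "DA i" "DB i" by (rule compact_game)
    have "exp (\<theta> * h i) = shapley g x $ i"
      using x(2) exp_h by simp
    also have "\<dots> = game_value (DA i) (DB i) (\<lambda>a b. stage_weight g i a b * continuation x i a b)"
      by (simp add: shapley_def)
    finally have "ereal (exp (\<theta> * h i)) = (SUP \<phi>\<in>prob_measures (DB i). INF \<psi>\<in>prob_measures (DA i).
        ereal (expected_payoff \<psi> \<phi> (\<lambda>a b. stage_weight g i a b * continuation x i a b)))"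
      by (simp only: game.ereal_game_value[OF payoff_stage])
    then show "ereal (exp (\<theta> * h i)) =
      (SUP \<phi>\<in>prob_measures (DB i). INF \<psi>\<in>prob_measures (DA i).
        ereal (LINT a|\<psi>. LINT b|\<phi>.
          exp (\<theta> * C i a b) *
          (LINT s:{0..sbar}|interval_measure (F i a b).
             exp (\<theta> * ((LINT t:{0..s}|lborel. \<rho> i a b t) - g * s))) *
          (\<Sum>j\<in>UNIV. exp (\<theta> * h j) * p i j a b)))"
      unfolding expected_payoff_def stage_weight_def continuation_def exp_h .
  qed
qed

end
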